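(* Let $G$ be a finite simple unmixed graph without $3$-cycles and without $5$-cycles. The following are equivalent: (a) $I_c(G)$ is linearly presented; (b) for all distinct minimal vertex covers $C_1,C_2$ of $G$, if the induced subgraph $G'=G[C_1\triangle C_2]$ is unmixed then $G'$ is Cohen–Macaulay.
   Context: $G$ has vertices $t_1,\dots,t_s$, $S=K[t_1,\dots,t_s]$, $K$ a field. A graph is unmixed if all minimal vertex covers (inclusion-minimal vertex sets meeting every edge) have equal size. $I_c(G)$ is generated by $\prod_{t_i\in C}t_i$ over minimal vertex covers $C$; a monomial ideal minimally generated by $u_1,\dots,u_r$ is linearly presented if all $u_i$ have the same degree and the kernel of $S^r\to S$, $e_i\mapsto u_i$, is generated by vectors with linear-form entries. $\triangle$ is symmetric difference, $G[L]$ the subgraph induced on $L$. A graph $H$ is Cohen–Macaulay if $R/I(H)$ is Cohen–Macaulay, with $R$ the polynomial ring on $V(H)$ and $I(H)$ generated by $tt'$ for edges $\{t,t'\}$ of $H$. *)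

theory Defs
  imports "HOL-Library.Poly_Mapping" "HOL-Library.Extended_Nat"
begin

definition simple_graph :: "'v set \<Rightarrow> 'v set set \<Rightarrow> bool" where
  "simple_graph V E \<longleftrightarrow> finite V \<and> (\<forall>e\<in>E. e \<subseteq> V \<and> card e = 2)"

definition adj :: "'v set set \<Rightarrow> 'v \<Rightarrow> 'v \<Rightarrow> bool" where
  "adj E a b \<longleftrightarrow> {a, b} \<in> E"

definition is_vertex_cover :: "'v set \<Rightarrow> 'v set set \<Rightarrow> 'v set \<Rightarrow> bool" where
  "is_vertex_cover V E C \<longleftrightarrow> C \<subseteq> V \<and> (\<forall>e\<in>E. e \<inter> C \<noteq> {})"

definition min_vertex_cover :: "'v set \<Rightarrow> 'v set set \<Rightarrow> 'v set \<Rightarrow> bool" where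
  "min_vertex_cover V E C \<longleftrightarrow> is_vertex_cover V E C \<and>
     (\<forall>D. D \<subset> C \<longrightarrow> \<not> is_vertex_cover V E D)"

definition unmixed :: "'v set \<Rightarrow> 'v set set \<Rightarrow> bool" where
  "unmixed V E \<longleftrightarrow> (\<forall>C D. min_vertex_cover V E C \<and> min_vertex_cover V E D \<longrightarrow> card C = card D)"

definition no_3_cycle :: "'v set set \<Rightarrow> bool" where
  "no_3_cycle E \<longleftrightarrow> \<not> (\<exists>a b c. distinct [a, b, c] \<and> adj E a b \<and> adj E b c \<and> adj E c a)"

definition no_5_cycle :: "'v set set \<Rightarrow> bool" where
  "no_5_cycle E \<longleftrightarrow> \<not> (\<exists>a b c d f. distinct [a, b, c, d, f] \<and> adj E a b \<and> adj E b c \<and>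
      adj E c d \<and> adj E d f \<and> adj E f a)"

definition induced_edges :: "'v set set \<Rightarrow> 'v set \<Rightarrow> 'v set set" where
  "induced_edges E L = {e \<in> E. e \<subseteq> L}"

type_synonym ('v, 'k) mpoly = "('v \<Rightarrow>\<^sub>0 nat) \<Rightarrow>\<^sub>0 'k"

definition polys :: "'k::field itself \<Rightarrow> 'v set \<Rightarrow> ('v, 'k) mpoly set" where
  "polys _ V = {p :: ('v, 'k) mpoly. \<forall>m\<in>Poly_Mapping.keys p. Poly_Mapping.keys m \<subseteq> V}"

definition var :: "'v \<Rightarrow> ('v, 'k::field) mpoly" where
  "var v = Poly_Mapping.single (Poly_Mapping.single v 1) 1"

definition mono_deg :: "('v \<Rightarrow>\<^sub>0 nat) \<Rightarrow> nat" where
  "mono_deg m = (\<Sum>v\<in>Poly_Mapping.keys m. Poly_Mapping.lookup m v)"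

definition homogeneous_of_deg :: "nat \<Rightarrow> ('v, 'k::field) mpoly \<Rightarrow> bool" where
  "homogeneous_of_deg d p \<longleftrightarrow> (\<forall>m\<in>Poly_Mapping.keys p. mono_deg m = d)"

text \<open>Linear forms (homogeneous of degree one; zero allowed).\<close>
abbreviation linear_form :: "('v, 'k::field) mpoly \<Rightarrow> bool" where
  "linear_form p \<equiv> homogeneous_of_deg 1 p"

definition is_ideal :: "'k::field itself \<Rightarrow> 'v set \<Rightarrow> ('v, 'k) mpoly set \<Rightarrow> bool" where
  "is_ideal K V I \<longleftrightarrow> I \<subseteq> polys K V \<and> 0 \<in> I \<and> (\<forall>a\<in>I. \<forall>b\<in>I. a + b \<in> I) \<and>
     (\<forall>r\<in>polys K V. \<forall>a\<in>I. r * a \<in> I)"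

definition gen_ideal :: "'k::field itself \<Rightarrow> 'v set \<Rightarrow> ('v, 'k) mpoly set \<Rightarrow> ('v, 'k) mpoly set" where
  "gen_ideal K V A = \<Inter> {I. is_ideal K V I \<and> A \<subseteq> I}"

definition is_prime_ideal :: "'k::field itself \<Rightarrow> 'v set \<Rightarrow> ('v, 'k) mpoly set \<Rightarrow> bool" where
  "is_prime_ideal K V P \<longleftrightarrow> is_ideal K V P \<and> 1 \<notin> P \<and>
     (\<forall>a\<in>polys K V. \<forall>b\<in>polys K V. a * b \<in> P \<longrightarrow> a \<in> P \<or> b \<in> P)"

definition krull_dim_quot :: "'k::field itself \<Rightarrow> 'v set \<Rightarrow> ('v, 'k) mpoly set \<Rightarrow> enat" where
  "krull_dim_quot K V I = Sup {enat n | n. \<exists>P :: nat \<Rightarrow> ('v, 'k) mpoly set.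
      (\<forall>i\<le>n. is_prime_ideal K V (P i) \<and> I \<subseteq> P i) \<and> (\<forall>i<n. P i \<subset> P (Suc i))}"

definition max_hom_ideal :: "'k::field itself \<Rightarrow> 'v set \<Rightarrow> ('v, 'k) mpoly set" where
  "max_hom_ideal K V = gen_ideal K V (var ` V)"

definition regular_seq :: "'k::field itself \<Rightarrow> 'v set \<Rightarrow> ('v, 'k) mpoly set \<Rightarrow> ('v, 'k) mpoly list \<Rightarrow> bool" where
  "regular_seq K V I fs \<longleftrightarrow> set fs \<subseteq> max_hom_ideal K V \<and>
     (\<forall>i<length fs. \<forall>g\<in>polys K V.
        fs ! i * g \<in> gen_ideal K V (I \<union> set (take i fs)) \<longrightarrow> g \<in> gen_ideal K V (I \<union> set (take i fs))) \<and>
     1 \<notin> gen_ideal K V (I \<union> set fs)"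

definition depth_quot :: "'k::field itself \<Rightarrow> 'v set \<Rightarrow> ('v, 'k) mpoly set \<Rightarrow> enat" where
  "depth_quot K V I = Sup {enat (length fs) | fs. regular_seq K V I fs}"

text \<open>K[V]/I (I homogeneous) is Cohen-Macaulay: depth (w.r.t. the maximal homogeneous ideal)
  equals Krull dimension.\<close>
definition cohen_macaulay_quot :: "'k::field itself \<Rightarrow> 'v set \<Rightarrow> ('v, 'k) mpoly set \<Rightarrow> bool" where
  "cohen_macaulay_quot K V I \<longleftrightarrow> depth_quot K V I = krull_dim_quot K V I"

definition edge_ideal :: "'k::field itself \<Rightarrow> 'v set \<Rightarrow> 'v set set \<Rightarrow> ('v, 'k) mpoly set" where
  "edge_ideal K V E = gen_ideal K V {var a * var b | a b. {a, b} \<in> E}"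

definition cohen_macaulay_graph :: "'k::field itself \<Rightarrow> 'v set \<Rightarrow> 'v set set \<Rightarrow> bool" where
  "cohen_macaulay_graph K V E \<longleftrightarrow> cohen_macaulay_quot K V (edge_ideal K V E)"

definition cover_monomial :: "'v set \<Rightarrow> ('v, 'k::field) mpoly" where
  "cover_monomial C = (\<Prod>t\<in>C. var t)"

text \<open>A monomial ideal with minimal generators u_j (j \<in> J), is linearly presented if all u_j have the same
  degree and the kernel of S^J \<rightarrow> S, e_j \<mapsto> u_j, is generated (as S-module) by vectors with linear-form
  entries. Vectors of S^J are functions J \<rightarrow> S (zero outside J).\<close>
definition syz_kernel :: "'k::field itself \<Rightarrow> 'v set \<Rightarrow> 'j set \<Rightarrow> ('j \<Rightarrow> ('v, 'k) mpoly)
    \<Rightarrow> ('j \<Rightarrow> ('v, 'k) mpoly) set" where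
  "syz_kernel K V J u = {x. (\<forall>j\<in>J. x j \<in> polys K V) \<and> (\<forall>j. j \<notin> J \<longrightarrow> x j = 0) \<and>
      (\<Sum>j\<in>J. x j * u j) = 0}"

definition module_span :: "'k::field itself \<Rightarrow> 'v set \<Rightarrow> ('j \<Rightarrow> ('v, 'k) mpoly) set
    \<Rightarrow> ('j \<Rightarrow> ('v, 'k) mpoly) set" where
  "module_span K V B = {(\<lambda>j. \<Sum>i<(n::nat). c i * b i j) | n c b.
      (\<forall>i<n. c i \<in> polys K V \<and> b i \<in> B)}"

definition linearly_presented :: "'k::field itself \<Rightarrow> 'v set \<Rightarrow> 'j set \<Rightarrow> ('j \<Rightarrow> ('v, 'k) mpoly) \<Rightarrow> bool" where
  "linearly_presented K V J u \<longleftrightarrow>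
     (\<exists>d. \<forall>j\<in>J. homogeneous_of_deg d (u j)) \<and>
     syz_kernel K V J u \<subseteq>
       module_span K V {x \<in> syz_kernel K V J u. \<forall>j\<in>J. linear_form (x j)}"

text \<open>I_c(G) is linearly presented: the generators are the cover monomials of the minimal vertex
  covers (these are precisely the minimal monomial generators).\<close>
definition cover_ideal_linearly_presented :: "'k::field itself \<Rightarrow> 'v set \<Rightarrow> 'v set set \<Rightarrow> bool" where
  "cover_ideal_linearly_presented K V E \<longleftrightarrow>
     linearly_presented K V {C. min_vertex_cover V E C} (\<lambda>C. cover_monomial C :: ('v, 'k) mpoly)"

end

theory Submission
  imports Defs "HOL-Library.FuncSet" "HOL-Library.Set_Algebras"
begin

text \<open>
  Both conditions are equivalent to the following one: if \<open>C\<close> and \<open>D\<close> are minimal vertex covers and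
  every vertex of \<open>C - D\<close> is adjacent to every vertex of \<open>D - C\<close>, then \<open>C - D\<close> has at most one
  element.

  If it fails for \<open>C\<close> and \<open>D\<close>, then, since there are no triangles, no minimal vertex cover inside
  \<open>C \<union> D\<close> arises from \<open>C\<close> by a single exchange, so the syzygy between \<open>C\<close> and \<open>D\<close> is not generated by
  linear ones; moreover the graph induced on the symmetric difference is a complete bipartite graph
  \<open>K\<^sub>m\<^sub>,\<^sub>m\<close> with \<open>m \<ge> 2\<close>, which is unmixed of depth 1 and dimension at least 2.

  If it holds, a nonadjacent pair \<open>a \<in> C - D\<close>, \<open>b \<in> D - C\<close> yields a minimal vertex cover inside
  \<open>C \<union> D - {a, b}\<close>, which is closer to both \<open>C\<close> and \<open>D\<close>. Induction on the distance shows that the pair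
  syzygies come from linear ones. When the graph on the symmetric difference is unmixed, the same
  induction produces a perfect matching \<open>\<mu>\<close> for which \<open>a \<sim> \<mu> a'\<close> is antisymmetric in \<open>a\<close> and \<open>a'\<close>;
  unmixedness makes this relation transitive, and then the elements \<open>a - \<mu> a\<close> form a regular sequence
  whose length is the dimension.
\<close>

section \<open>Polynomials and ideals\<close>

abbreviation "lookup \<equiv> Poly_Mapping.lookup"
abbreviation "keys \<equiv> Poly_Mapping.keys"
abbreviation "single \<equiv> Poly_Mapping.single"

definition adds :: "'a::plus \<Rightarrow> 'a \<Rightarrow> bool"  (infix \<open>adds\<close> 50) where
  "u adds w \<longleftrightarrow> (\<exists>l. w = u + l)"

lemma addsE:
  assumes "u adds w"
  obtains l where "w = u + l"
  using assms unfolding adds_def by blast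

lemma adds_triv [simp]: "u adds u + l"
  unfolding adds_def by blast

lemma adds_refl [simp]: "(u :: 'a::comm_monoid_add) adds u"
  unfolding adds_def by (intro exI[of _ 0]) simp

lemma adds_plus_left: "u adds w \<Longrightarrow> u adds (l :: 'a::ab_semigroup_add) + w"
  by (auto simp: adds_def intro: exI[of _ "l + _"] add.left_commute)

lemma adds_add_cancel_left: "u + v adds u + w \<longleftrightarrow> v adds (w :: 'a::cancel_comm_monoid_add)"
  by (simp add: adds_def add.assoc)

lemma add_minus_if_adds: "u adds w \<Longrightarrow> u + (w - u) = (w :: 'a::cancel_comm_monoid_add)"
  by (auto simp: adds_def)

lemma adds_iff_lookup_le: "(u :: 'v \<Rightarrow>\<^sub>0 nat) adds w \<longleftrightarrow> (\<forall>v. lookup u v \<le> lookup w v)"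
proof
  assume "\<forall>v. lookup u v \<le> lookup w v"
  then have "w = u + (w - u)"
    by (intro poly_mapping_eqI) (simp add: lookup_add lookup_minus)
  then show "u adds w"
    unfolding adds_def by blast
qed (auto simp: adds_def lookup_add)

lemma single_1_adds_iff: "single v 1 adds (w :: 'v \<Rightarrow>\<^sub>0 nat) \<longleftrightarrow> v \<in> keys w"
  by (auto simp: adds_iff_lookup_le lookup_single when_def in_keys_iff Suc_le_eq)

lemma keys_plus_nat: "keys (m + n :: 'v \<Rightarrow>\<^sub>0 nat) = keys m \<union> keys n"
  by (auto simp: in_keys_iff lookup_add)

lemma keys_minus_nat: "keys (m - n :: 'v \<Rightarrow>\<^sub>0 nat) \<subseteq> keys m"
  by (auto simp: in_keys_iff lookup_minus)

lemma keys_subset_if_adds: "(u :: 'v \<Rightarrow>\<^sub>0 nat) adds w \<Longrightarrow> keys u \<subseteq> keys w"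
  by (auto simp: adds_def keys_plus_nat)

lemma two_vars_adds_iff:
  "x \<noteq> y \<Longrightarrow> single x 1 + single y 1 adds (w :: 'v \<Rightarrow>\<^sub>0 nat) \<longleftrightarrow> x \<in> keys w \<and> y \<in> keys w"
  by (force simp: adds_iff_lookup_le lookup_add lookup_single when_def in_keys_iff Suc_le_eq)

lemma adds_single_plus_cancel:
  assumes "u adds single v 1 + w" "v \<notin> keys u"
  shows "u adds (w :: 'v \<Rightarrow>\<^sub>0 nat)"
  unfolding adds_iff_lookup_le
proof
  fix x
  show "lookup u x \<le> lookup w x"
    using assms by (cases "x = v")
      (auto simp: adds_iff_lookup_le lookup_add lookup_single in_keys_iff dest: spec[of _ x])
qed

lemma poly_mapping_sum_single: "(\<Sum>k\<in>keys p. single k (lookup p k)) = p"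
  by (rule poly_mapping_eqI)
     (simp add: lookup_sum lookup_single when_def sum.delta in_keys_iff)

lemma poly_mapping_additive_induct [case_names single add]:
  assumes single: "\<And>k c. P (single k c)"
    and add: "\<And>p q. P p \<Longrightarrow> P q \<Longrightarrow> P (p + q)"
  shows "P (p :: 'a \<Rightarrow>\<^sub>0 'b::comm_monoid_add)"
proof -
  have "P (\<Sum>k\<in>A. single k (lookup p k))" if "finite A" for A
    using that
  proof (induction A)
    case empty
    show ?case using single[of undefined 0] by simp
  qed (auto intro: single add)
  from this[of "keys p"] show ?thesis
    by (simp add: poly_mapping_sum_single)
qed

lemma sum_single_same: "(\<Sum>i\<in>S. single k (f i)) = single k (\<Sum>i\<in>S. f i)"
  by (induction S rule: infinite_finite_induct) (simp_all add: single_add)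

lemma lookup_single_mult:
  fixes p :: "'a::cancel_comm_monoid_add \<Rightarrow>\<^sub>0 'b::semiring_0"
  shows "lookup (single m c * p) k = (if m adds k then c * lookup p (k - m) else 0)"
proof (induction p rule: poly_mapping_additive_induct)
  case (single l d)
  have "m adds k \<and> l = k - m \<longleftrightarrow> m + l = k"
    by (auto simp: add_minus_if_adds)
  then show ?case
    by (auto simp: mult_single lookup_single when_def)
qed (auto simp: distrib_left lookup_add)

lemma keys_multE:
  assumes "k \<in> keys (p * q)"
  obtains a b where "k = a + b" "a \<in> keys p" "b \<in> keys q"
  using keys_mult[of p q] assms by blast

lemma keys_var [simp]: "keys (var v) = {single v 1}"
  by (simp add: var_def)

lemma lookup_var_mult:
  "lookup (var v * p) k = (if v \<in> keys k then lookup p (k - single v 1) else 0)"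
  using single_1_adds_iff[of v k] by (simp add: var_def lookup_single_mult)

lemma lookup_mult_monomial:
  fixes p :: "('v, 'k::field) mpoly"
  shows "lookup (p * single u 1) m = (if u adds m then lookup p (m - u) else 0)"
  by (simp add: mult.commute[of p] lookup_single_mult)

lemma polysI: "(\<And>m. m \<in> keys p \<Longrightarrow> keys m \<subseteq> V) \<Longrightarrow> p \<in> polys K V"
  by (auto simp: polys_def)

lemma polysD: "p \<in> polys K V \<Longrightarrow> m \<in> keys p \<Longrightarrow> keys m \<subseteq> V"
  by (auto simp: polys_def)

lemma polys_0 [simp, intro]: "0 \<in> polys K V"
  by (auto simp: polys_def)

lemma polys_1 [simp, intro]: "1 \<in> polys K V"
  by (auto simp: polys_def)

lemma polys_single: "keys m \<subseteq> V \<Longrightarrow> single m c \<in> polys K V"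
  by (auto simp: polys_def)

lemma polys_const [simp, intro]: "single 0 c \<in> polys K V"
  by (simp add: polys_single)

lemma polys_var [simp]: "var v \<in> polys K V \<longleftrightarrow> v \<in> V"
  by (auto simp: polys_def)

lemma polys_add [intro]: "p \<in> polys K V \<Longrightarrow> q \<in> polys K V \<Longrightarrow> p + q \<in> polys K V"
  using keys_add[of p q] by (force simp: polys_def)

lemma polys_mult [intro]:
  assumes "p \<in> polys K V" "q \<in> polys K V"
  shows "p * q \<in> polys K V"
  using polysD[OF assms(1)] polysD[OF assms(2)]
  by (intro polysI) (auto elim!: keys_multE simp: keys_plus_nat subset_iff)

lemma polys_uminus [intro]: "p \<in> polys K V \<Longrightarrow> - p \<in> polys K V"
  by (auto simp: polys_def in_keys_iff)

lemma polys_diff [intro]: "p \<in> polys K V \<Longrightarrow> q \<in> polys K V \<Longrightarrow> p - q \<in> polys K V"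
  using polys_add[of p K V "- q"] by auto

lemma polys_power [intro]: "p \<in> polys K V \<Longrightarrow> p ^ n \<in> polys K V"
  by (induction n) auto

lemma polys_sum: "(\<And>i. i \<in> A \<Longrightarrow> f i \<in> polys K V) \<Longrightarrow> sum f A \<in> polys K V"
  by (induction A rule: infinite_finite_induct) auto

lemma prod_single: "(\<Prod>i\<in>A. single (f i) 1) = single (\<Sum>i\<in>A. f i) (1 :: 'b::comm_semiring_1)"
  by (induction A rule: infinite_finite_induct) (simp_all add: mult_single)

lemma single_eq_prod_var:
  fixes m :: "'v \<Rightarrow>\<^sub>0 nat"
  shows "single m (1 :: 'k::field) = (\<Prod>v\<in>keys m. var v ^ lookup m v)"
proof -
  have "var v ^ n = single (single v n) (1 :: 'k)" for v :: 'v and n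
    by (induction n) (simp_all add: var_def mult_single single_add[symmetric])
  then show ?thesis
    by (simp add: prod_single poly_mapping_sum_single)
qed

lemma polys_induct [consumes 1, case_names const var add mult]:
  fixes K :: "'k::field itself"
  assumes p: "p \<in> polys K V"
    and const: "\<And>c. P (single 0 c)"
    and var: "\<And>v. v \<in> V \<Longrightarrow> P (var v)"
    and add: "\<And>p q. p \<in> polys K V \<Longrightarrow> q \<in> polys K V \<Longrightarrow> P p \<Longrightarrow> P q \<Longrightarrow> P (p + q)"
    and mult: "\<And>p q. p \<in> polys K V \<Longrightarrow> q \<in> polys K V \<Longrightarrow> P p \<Longrightarrow> P q \<Longrightarrow> P (p * q)"
  shows "P p"
proof -
  let ?P = "\<lambda>p. p \<in> polys K V \<and> P p"
  have constants: "?P (single 0 c)" for c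
    using const by simp
  have one: "?P 1" and zero: "?P 0"
    using const[of 1] const[of 0] by simp_all
  have power: "?P (var v ^ n)" if "v \<in> V" for v n
    using one that by (induction n) (simp_all add: var mult polys_mult)
  have monomial: "?P (single m 1)" if "keys m \<subseteq> V" for m
  proof -
    have "?P (\<Prod>v\<in>X. var v ^ lookup m v)" if "X \<subseteq> V" for X
      using that one power
      by (induction X rule: infinite_finite_induct) (simp_all add: mult polys_mult)
    then show ?thesis using that by (simp add: single_eq_prod_var)
  qed
  have "?P (single 0 (lookup p m) * single m 1)" if "m \<in> keys p" for m
    using constants monomial[OF polysD[OF p that]] mult polys_mult by blast
  then have "?P (single m (lookup p m))" if "m \<in> keys p" for m
    using that by (simp add: mult_single)
  then have "?P (\<Sum>m\<in>X. single m (lookup p m))" if "X \<subseteq> keys p" for X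
    using that zero by (induction X rule: infinite_finite_induct) (simp_all add: add polys_add)
  from this[of "keys p"] show ?thesis
    by (simp add: poly_mapping_sum_single)
qed

lemma is_idealD:
  assumes "is_ideal K V I"
  shows "I \<subseteq> polys K V" "0 \<in> I" "a \<in> I \<Longrightarrow> b \<in> I \<Longrightarrow> a + b \<in> I"
    "r \<in> polys K V \<Longrightarrow> a \<in> I \<Longrightarrow> r * a \<in> I"
  using assms by (auto simp: is_ideal_def)

lemma is_ideal_mult_right:
  assumes "is_ideal K V I" "r \<in> polys K V" "a \<in> I"
  shows "a * r \<in> I"
  using is_idealD(4)[OF assms] by (simp add: mult.commute)

lemma is_ideal_uminus:
  assumes "is_ideal K V I" "a \<in> I"
  shows "- a \<in> I"
  using is_idealD(4)[OF assms(1) polys_uminus[OF polys_1] assms(2)] by simp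

lemma is_ideal_diff:
  assumes "is_ideal K V I" "a \<in> I" "b \<in> I"
  shows "a - b \<in> I"
  using is_idealD(3)[OF assms(1,2) is_ideal_uminus[OF assms(1,3)]] by simp

lemma is_ideal_add_cancel_left:
  assumes "is_ideal K V I" "a \<in> I"
  shows "a + b \<in> I \<longleftrightarrow> b \<in> I"
  using is_ideal_diff[OF assms(1) _ assms(2), of "a + b"] is_idealD(3)[OF assms] by auto

lemma is_ideal_sum:
  assumes "is_ideal K V I" "\<And>i. i \<in> A \<Longrightarrow> f i \<in> I"
  shows "sum f A \<in> I"
  using assms(2)
  by (induction A rule: infinite_finite_induct) (simp_all add: is_idealD(2,3)[OF assms(1)])

lemma is_ideal_polys: "is_ideal K V (polys K V)"
  by (auto simp: is_ideal_def)

lemma is_ideal_principal: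
  assumes "f \<in> polys K V"
  shows "is_ideal K V (f *o polys K V)"
  unfolding is_ideal_def elt_set_times_def
proof (intro conjI ballI)
  show "0 \<in> {b. \<exists>h\<in>polys K V. b = f * h}" by force
next
  fix r a assume "r \<in> polys K V" "a \<in> {b. \<exists>h\<in>polys K V. b = f * h}"
  then show "r * a \<in> {b. \<exists>h\<in>polys K V. b = f * h}"
    by (auto intro!: bexI[of _ "r * _"] simp: mult.left_commute)
qed (use assms in \<open>auto simp: distrib_left[symmetric]\<close>)

lemma is_ideal_plus:
  assumes I: "is_ideal K V I" and J: "is_ideal K V J"
  shows "is_ideal K V (I + J)"
  unfolding is_ideal_def
proof (intro conjI ballI)
  show "I + J \<subseteq> polys K V"
    using is_idealD(1)[OF I] is_idealD(1)[OF J] by (auto elim!: set_plus_elim)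
  show "0 \<in> I + J"
    using set_plus_intro[OF is_idealD(2)[OF I] is_idealD(2)[OF J]] by simp
next
  fix a b assume "a \<in> I + J" "b \<in> I + J"
  then obtain i j i' j' where "a = i + j" "b = i' + j'" "i \<in> I" "i' \<in> I" "j \<in> J" "j' \<in> J"
    by (auto elim!: set_plus_elim)
  then have "a + b = (i + i') + (j + j')" "i + i' \<in> I" "j + j' \<in> J"
    using is_idealD(3)[OF I] is_idealD(3)[OF J] by (auto simp: algebra_simps)
  then show "a + b \<in> I + J"
    by auto
next
  fix r a assume "r \<in> polys K V" "a \<in> I + J"
  then show "r * a \<in> I + J"
    using is_idealD(4)[OF I] is_idealD(4)[OF J]
    by (auto elim!: set_plus_elim simp: distrib_left intro!: set_plus_intro)
qed

lemma gen_ideal_superset: "A \<subseteq> gen_ideal K V A"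
  by (auto simp: gen_ideal_def)

lemma gen_ideal_base: "p \<in> A \<Longrightarrow> p \<in> gen_ideal K V A"
  using gen_ideal_superset[of A K V] by blast

lemma gen_ideal_least: "is_ideal K V I \<Longrightarrow> A \<subseteq> I \<Longrightarrow> gen_ideal K V A \<subseteq> I"
  by (auto simp: gen_ideal_def)

lemma is_ideal_gen_ideal:
  assumes "A \<subseteq> polys K V"
  shows "is_ideal K V (gen_ideal K V A)"
  using gen_ideal_least[OF is_ideal_polys assms] unfolding is_ideal_def gen_ideal_def by auto

lemma gen_ideal_of_ideal: "is_ideal K V I \<Longrightarrow> gen_ideal K V I = I"
  by (metis gen_ideal_least gen_ideal_superset subset_refl subset_antisym)

lemma gen_ideal_mono:
  assumes "A \<subseteq> B" "B \<subseteq> polys K V"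
  shows "gen_ideal K V A \<subseteq> gen_ideal K V B"
  using assms gen_ideal_superset[of B K V] by (intro gen_ideal_least is_ideal_gen_ideal) auto

lemma gen_ideal_singleton:
  assumes "f \<in> polys K V"
  shows "gen_ideal K V {f} = f *o polys K V"
proof
  have "f \<in> f *o polys K V"
    using set_times_intro2[of 1 "polys K V" f] by simp
  then show "gen_ideal K V {f} \<subseteq> f *o polys K V"
    by (intro gen_ideal_least is_ideal_principal assms) auto
  have "is_ideal K V (gen_ideal K V {f})"
    using assms by (intro is_ideal_gen_ideal) auto
  then show "f *o polys K V \<subseteq> gen_ideal K V {f}"
    by (auto simp: elt_set_times_def intro: is_ideal_mult_right gen_ideal_base)
qed

lemma gen_ideal_Un:
  assumes "A \<subseteq> polys K V" "B \<subseteq> polys K V"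
  shows "gen_ideal K V (A \<union> B) = gen_ideal K V A + gen_ideal K V B"
proof
  note ideal_A = is_ideal_gen_ideal[OF assms(1)] and ideal_B = is_ideal_gen_ideal[OF assms(2)]
  have "A \<subseteq> gen_ideal K V A + gen_ideal K V B"
    using set_plus_intro[OF gen_ideal_base is_idealD(2)[OF ideal_B]] by fastforce
  moreover have "B \<subseteq> gen_ideal K V A + gen_ideal K V B"
    using set_plus_intro[OF is_idealD(2)[OF ideal_A] gen_ideal_base] by fastforce
  ultimately show "gen_ideal K V (A \<union> B) \<subseteq> gen_ideal K V A + gen_ideal K V B"
    by (intro gen_ideal_least is_ideal_plus ideal_A ideal_B) simp
  have "is_ideal K V (gen_ideal K V (A \<union> B))"
    using assms by (intro is_ideal_gen_ideal) simp
  moreover have "gen_ideal K V A \<subseteq> gen_ideal K V (A \<union> B)" "gen_ideal K V B \<subseteq> gen_ideal K V (A \<union> B)"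
    using assms by (intro gen_ideal_mono; simp)+
  ultimately show "gen_ideal K V A + gen_ideal K V B \<subseteq> gen_ideal K V (A \<union> B)"
    by (auto elim!: set_plus_elim intro: is_idealD(3))
qed

lemma gen_ideal_insert:
  assumes "is_ideal K V I" "f \<in> polys K V"
  shows "gen_ideal K V (insert f I) = I + f *o polys K V"
  using gen_ideal_Un[of I K V "{f}"] is_idealD(1)[OF assms(1)] assms(2)
  by (simp add: gen_ideal_of_ideal[OF assms(1)] gen_ideal_singleton)

abbreviation vars_ideal :: "'k::field itself \<Rightarrow> 'v set \<Rightarrow> 'v set \<Rightarrow> ('v, 'k) mpoly set" where
  "vars_ideal K V X \<equiv> gen_ideal K V (var ` X)"

lemma max_hom_ideal_subset_polys: "max_hom_ideal K V \<subseteq> polys K V"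
  unfolding max_hom_ideal_def by (rule gen_ideal_least[OF is_ideal_polys]) auto

lemma var_in_max_hom_ideal: "v \<in> V \<Longrightarrow> var v \<in> max_hom_ideal K V"
  unfolding max_hom_ideal_def by (rule gen_ideal_base) simp

section \<open>Prime ideals and regular sequences\<close>

lemma is_prime_idealD:
  assumes "is_prime_ideal K V P"
  shows "is_ideal K V P" "1 \<notin> P"
    "a \<in> polys K V \<Longrightarrow> b \<in> polys K V \<Longrightarrow> a * b \<in> P \<Longrightarrow> a \<in> P \<or> b \<in> P"
  using assms by (auto simp: is_prime_ideal_def)

lemma const_in_prime_ideal_iff:
  assumes P: "is_prime_ideal K V P"
  shows "single 0 c \<in> P \<longleftrightarrow> c = 0"
proof
  assume "single 0 c \<in> P"
  then have "single 0 (inverse c) * single 0 c \<in> P"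
    by (intro is_idealD(4)[OF is_prime_idealD(1)[OF P]] polys_const)
  then show "c = 0"
    using is_prime_idealD(2)[OF P] by (cases "c = 0") (auto simp: mult_single)
qed (simp add: is_idealD(2)[OF is_prime_idealD(1)[OF P]])

definition multiplicative_set :: "'a::comm_monoid_mult set \<Rightarrow> bool" where
  "multiplicative_set M \<longleftrightarrow> 1 \<in> M \<and> (\<forall>a\<in>M. \<forall>b\<in>M. a * b \<in> M)"

lemma is_ideal_Union_chain:
  assumes ideal: "\<And>I. I \<in> \<I> \<Longrightarrow> is_ideal K V I" and nonempty: "\<I> \<noteq> {}"
    and chain: "\<And>I J. I \<in> \<I> \<Longrightarrow> J \<in> \<I> \<Longrightarrow> I \<subseteq> J \<or> J \<subseteq> I"
  shows "is_ideal K V (\<Union>\<I>)"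
  unfolding is_ideal_def
proof (intro conjI ballI)
  show "\<Union>\<I> \<subseteq> polys K V" using is_idealD(1)[OF ideal] by blast
  show "0 \<in> \<Union>\<I>" using nonempty is_idealD(2)[OF ideal] by blast
next
  fix a b assume "a \<in> \<Union>\<I>" "b \<in> \<Union>\<I>"
  then obtain I J where "a \<in> I" "I \<in> \<I>" "b \<in> J" "J \<in> \<I>" by blast
  then show "a + b \<in> \<Union>\<I>" using chain[of I J] is_idealD(3)[OF ideal] by blast
next
  fix r a assume "r \<in> polys K V" "a \<in> \<Union>\<I>"
  then show "r * a \<in> \<Union>\<I>" using is_idealD(4)[OF ideal] by blast
qed

lemma is_prime_ideal_if_maximal_avoiding:
  assumes I: "is_ideal K V I" and M: "multiplicative_set M" and avoids: "I \<inter> M = {}"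
    and maximal: "\<And>J. is_ideal K V J \<Longrightarrow> I \<subseteq> J \<Longrightarrow> J \<inter> M = {} \<Longrightarrow> J = I"
  shows "is_prime_ideal K V I"
  unfolding is_prime_ideal_def
proof (intro conjI ballI impI I)
  show "1 \<notin> I" using M avoids by (auto simp: multiplicative_set_def)
  have meets: "\<exists>i\<in>I. \<exists>h\<in>polys K V. i + a * h \<in> M" if a: "a \<in> polys K V" "a \<notin> I" for a
  proof -
    have "insert a I \<subseteq> I + a *o polys K V"
      using gen_ideal_superset[of "insert a I" K V] by (simp add: gen_ideal_insert[OF I a(1)])
    then have "(I + a *o polys K V) \<inter> M \<noteq> {}"
      using maximal[OF is_ideal_plus[OF I is_ideal_principal[OF a(1)]]] a(2) by blast
    then show ?thesis by (auto simp: set_plus_def elt_set_times_def)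
  qed
  fix a b assume ab: "a \<in> polys K V" "b \<in> polys K V" "a * b \<in> I"
  show "a \<in> I \<or> b \<in> I"
  proof (rule ccontr)
    assume "\<not> (a \<in> I \<or> b \<in> I)"
    then obtain i h i' h' where ih: "i \<in> I" "h \<in> polys K V" "i + a * h \<in> M"
      and ih': "i' \<in> I" "h' \<in> polys K V" "i' + b * h' \<in> M"
      using meets[of a] meets[of b] ab by metis
    have "(i + a * h) * (i' + b * h') = i * (i' + b * h') + i' * (a * h) + (a * b) * (h * h')"
      by (simp add: algebra_simps)
    also have "\<dots> \<in> I"
    proof (intro is_idealD(3)[OF I])
      have "i' \<in> polys K V" using ih'(1) is_idealD(1)[OF I] by blast
      then show "i * (i' + b * h') \<in> I" "i' * (a * h) \<in> I" "(a * b) * (h * h') \<in> I"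
        using ab ih(1,2) ih'(1,2) by (auto intro!: is_ideal_mult_right[OF I])
    qed
    finally show False
      using M avoids ih(3) ih'(3) by (auto simp: multiplicative_set_def)
  qed
qed

lemma prime_ideal_avoiding:
  assumes J: "is_ideal K V J" and M: "multiplicative_set M" and avoids: "J \<inter> M = {}"
  obtains Q where "is_prime_ideal K V Q" "J \<subseteq> Q" "Q \<inter> M = {}"
proof -
  define A where "A = {I. is_ideal K V I \<and> J \<subseteq> I \<and> I \<inter> M = {}}"
  have "\<exists>Q\<in>A. \<forall>X\<in>A. Q \<subseteq> X \<longrightarrow> X = Q"
  proof (rule subset_Zorn_nonempty)
    show "A \<noteq> {}" using J avoids by (auto simp: A_def)
  next
    fix \<I> assume nonempty: "\<I> \<noteq> {}" and chain: "subset.chain A \<I>"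
    then have "is_ideal K V (\<Union>\<I>)"
      by (intro is_ideal_Union_chain) (auto simp: A_def subset_chain_def)
    then show "\<Union>\<I> \<in> A"
      using nonempty chain by (auto simp: A_def subset_chain_def)
  qed
  then obtain Q where "Q \<in> A" and maximal: "\<And>X. X \<in> A \<Longrightarrow> Q \<subseteq> X \<Longrightarrow> X = Q" by blast
  then have Q: "is_ideal K V Q" "J \<subseteq> Q" "Q \<inter> M = {}" by (auto simp: A_def)
  then have "is_prime_ideal K V Q"
    by (intro is_prime_ideal_if_maximal_avoiding[OF Q(1) M Q(3)] maximal) (auto simp: A_def)
  then show thesis using that Q by blast
qed

definition regular_mod ::
    "'k::field itself \<Rightarrow> 'v set \<Rightarrow> ('v, 'k) mpoly set \<Rightarrow> ('v, 'k) mpoly \<Rightarrow> bool" where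
  "regular_mod K V I f \<longleftrightarrow> (\<forall>g\<in>polys K V. f * g \<in> I \<longrightarrow> g \<in> I)"

lemma regular_modD: "regular_mod K V I f \<Longrightarrow> g \<in> polys K V \<Longrightarrow> f * g \<in> I \<Longrightarrow> g \<in> I"
  by (simp add: regular_mod_def)

lemma regular_mod_power:
  assumes "regular_mod K V I f" "f \<in> polys K V"
  shows "regular_mod K V I (f ^ n)"
proof (induction n)
  case (Suc n)
  show ?case
    unfolding regular_mod_def
  proof (intro ballI impI)
    fix g assume g: "g \<in> polys K V" and "f ^ Suc n * g \<in> I"
    then have "f * (f ^ n * g) \<in> I" by (simp add: mult.assoc)
    moreover have "f ^ n * g \<in> polys K V" using assms(2) g by blast
    ultimately have "f ^ n * g \<in> I" by (metis regular_modD assms(1))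
    then show "g \<in> I" by (rule regular_modD[OF Suc g])
  qed
qed (simp add: regular_mod_def)

text \<open>The prime is found by avoiding all products \<open>s * f ^ n\<close> with \<open>s \<notin> P\<close>.\<close>

lemma regular_element_smaller_prime:
  assumes P: "is_prime_ideal K V P" and J: "is_ideal K V J" "J \<subseteq> P"
    and f: "f \<in> P" and regular: "regular_mod K V J f"
  obtains Q where "is_prime_ideal K V Q" "J \<subseteq> Q" "Q \<subset> P"
proof -
  define M where "M = {s * f ^ n | s n. s \<in> polys K V \<and> s \<notin> P}"
  have f_polys: "f \<in> polys K V" using f is_idealD(1)[OF is_prime_idealD(1)[OF P]] by blast
  have in_M: "s * f ^ n \<in> M" if "s \<in> polys K V" "s \<notin> P" for s n
    unfolding M_def using that by blast
  have "s * f ^ n * (t * f ^ k) \<in> M"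
    if "s \<in> polys K V" "s \<notin> P" "t \<in> polys K V" "t \<notin> P" for s t n k
  proof -
    have "s * t \<notin> P" using is_prime_idealD(3)[OF P] that by blast
    then have "(s * t) * f ^ (n + k) \<in> M" using that by (intro in_M) auto
    then show ?thesis by (simp add: power_add mult_ac)
  qed
  then have "multiplicative_set M"
    using in_M[of 1 0] is_prime_idealD(2)[OF P] by (auto simp: multiplicative_set_def M_def)
  moreover have "J \<inter> M = {}"
    using regular_modD[OF regular_mod_power[OF regular f_polys]] J(2)
    by (fastforce simp: M_def mult.commute)
  ultimately obtain Q where Q: "is_prime_ideal K V Q" "J \<subseteq> Q" "Q \<inter> M = {}"
    by (rule prime_ideal_avoiding[OF J(1)])
  have "s \<in> P" if "s \<in> Q" for s
    using in_M[of s 0] that Q(3) is_idealD(1)[OF is_prime_idealD(1)[OF Q(1)]] by auto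
  moreover have "f \<notin> Q"
    using in_M[of 1 1] Q(3) is_prime_idealD(2)[OF P] by auto
  ultimately show thesis using that[OF Q(1,2)] f by blast
qed

definition prime_chain :: "'k::field itself \<Rightarrow> 'v set \<Rightarrow> ('v, 'k) mpoly set \<Rightarrow>
    (nat \<Rightarrow> ('v, 'k) mpoly set) \<Rightarrow> nat \<Rightarrow> bool" where
  "prime_chain K V I P n \<longleftrightarrow>
     (\<forall>i\<le>n. is_prime_ideal K V (P i) \<and> I \<subseteq> P i) \<and> (\<forall>i<n. P i \<subset> P (Suc i))"

lemma prime_chain_above_first:
  assumes chain: "prime_chain K V I P n"
  shows "prime_chain K V (P 0) P n"
proof -
  have "P 0 \<subseteq> P i" if "i \<le> n" for i
    using that
  proof (induction i)
    case (Suc i)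
    then have "P i \<subset> P (Suc i)" using chain by (simp add: prime_chain_def)
    then show ?case using Suc by simp
  qed simp
  then show ?thesis using chain by (simp add: prime_chain_def)
qed

lemma krull_dim_quot_ge: "prime_chain K V I P n \<Longrightarrow> enat n \<le> krull_dim_quot K V I"
  unfolding krull_dim_quot_def prime_chain_def by (intro Sup_upper) blast

lemma krull_dim_quot_le:
  assumes "\<And>P n. prime_chain K V I P n \<Longrightarrow> enat n \<le> d"
  shows "krull_dim_quot K V I \<le> d"
  unfolding krull_dim_quot_def using assms by (intro Sup_least) (auto simp: prime_chain_def)

lemma krull_dim_quot_antimono:
  assumes "I \<subseteq> gen_ideal K V J"
  shows "krull_dim_quot K V J \<le> krull_dim_quot K V I"
proof (rule krull_dim_quot_le)
  fix P n assume chain: "prime_chain K V J P n"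
  have "I \<subseteq> Q" if "is_prime_ideal K V Q" "J \<subseteq> Q" for Q
    using assms gen_ideal_least[OF is_prime_idealD(1)] that by blast
  then have "prime_chain K V I P n"
    using chain by (simp add: prime_chain_def)
  then show "enat n \<le> krull_dim_quot K V I" by (rule krull_dim_quot_ge)
qed

definition weakly_regular_seq ::
    "'k::field itself \<Rightarrow> 'v set \<Rightarrow> ('v, 'k) mpoly set \<Rightarrow> ('v, 'k) mpoly list \<Rightarrow> bool" where
  "weakly_regular_seq K V I fs \<longleftrightarrow>
     (\<forall>i<length fs. regular_mod K V (gen_ideal K V (I \<union> set (take i fs))) (fs ! i))"

lemma weakly_regular_seq_Nil [simp]: "weakly_regular_seq K V I []"
  by (simp add: weakly_regular_seq_def)

lemma weakly_regular_seqD: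
  "weakly_regular_seq K V I fs \<Longrightarrow> i < length fs \<Longrightarrow>
    regular_mod K V (gen_ideal K V (I \<union> set (take i fs))) (fs ! i)"
  by (simp add: weakly_regular_seq_def)

lemma weakly_regular_seq_snoc [simp]:
  "weakly_regular_seq K V I (fs @ [f]) \<longleftrightarrow>
     weakly_regular_seq K V I fs \<and> regular_mod K V (gen_ideal K V (I \<union> set fs)) f"
  by (auto simp: weakly_regular_seq_def less_Suc_eq nth_append)

lemma regular_seq_iff:
  "regular_seq K V I fs \<longleftrightarrow> weakly_regular_seq K V I fs \<and> set fs \<subseteq> max_hom_ideal K V \<and>
     1 \<notin> gen_ideal K V (I \<union> set fs)"
  by (auto simp: regular_seq_def weakly_regular_seq_def regular_mod_def)

lemma weakly_regular_seq_prime_chain: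
  assumes "weakly_regular_seq K V I fs" "is_prime_ideal K V Q" "I \<union> set fs \<subseteq> Q"
  shows "\<exists>P. prime_chain K V I P (length fs) \<and> P (length fs) = Q"
  using assms
proof (induction fs arbitrary: Q rule: rev_induct)
  case Nil
  then show ?case by (intro exI[of _ "\<lambda>_. Q"]) (simp add: prime_chain_def)
next
  case (snoc f fs)
  define J where "J = gen_ideal K V (I \<union> set fs)"
  have ideal_Q: "is_ideal K V Q" by (rule is_prime_idealD(1)[OF snoc.prems(2)])
  have ideal_J: "is_ideal K V J"
    unfolding J_def using snoc.prems(3) is_idealD(1)[OF ideal_Q] by (intro is_ideal_gen_ideal) auto
  have J_subset: "J \<subseteq> Q"
    unfolding J_def using snoc.prems(3) by (intro gen_ideal_least[OF ideal_Q]) auto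
  have f: "f \<in> Q" "regular_mod K V J f"
    using snoc.prems by (auto simp: J_def)
  obtain Q' where Q': "is_prime_ideal K V Q'" "J \<subseteq> Q'" "Q' \<subset> Q"
    by (rule regular_element_smaller_prime[OF snoc.prems(2) ideal_J J_subset f])
  have "I \<union> set fs \<subseteq> Q'"
    using Q'(2) gen_ideal_superset unfolding J_def by blast
  then obtain P where P: "prime_chain K V I P (length fs)" "P (length fs) = Q'"
    using snoc.IH[of Q'] snoc.prems(1) Q'(1) by auto
  have "prime_chain K V I (P(Suc (length fs) := Q)) (length (fs @ [f]))"
    using P Q'(3) snoc.prems(2,3) by (auto simp: prime_chain_def le_Suc_eq less_Suc_eq)
  moreover have "(P(Suc (length fs) := Q)) (length (fs @ [f])) = Q" by simp
  ultimately show ?case by blast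
qed

lemma length_regular_seq_le_krull_dim_quot:
  fixes I :: "('v, 'k::field) mpoly set"
  assumes fs: "regular_seq K V I fs" and I: "I \<subseteq> polys K V"
  shows "enat (length fs) \<le> krull_dim_quot K V I"
proof -
  have "I \<union> set fs \<subseteq> polys K V"
    using fs I max_hom_ideal_subset_polys[of K V] by (auto simp: regular_seq_iff)
  moreover have "gen_ideal K V (I \<union> set fs) \<inter> {1} = {}"
    using fs by (simp add: regular_seq_iff)
  moreover have "multiplicative_set {1 :: ('v, 'k) mpoly}"
    by (simp add: multiplicative_set_def)
  ultimately obtain Q where "is_prime_ideal K V Q" "gen_ideal K V (I \<union> set fs) \<subseteq> Q"
    by (metis prime_ideal_avoiding is_ideal_gen_ideal)
  then obtain P where "prime_chain K V I P (length fs)"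
    using weakly_regular_seq_prime_chain[of K V I fs Q] fs gen_ideal_superset[of "I \<union> set fs" K V]
    by (auto simp: regular_seq_iff)
  then show ?thesis by (rule krull_dim_quot_ge)
qed

lemma depth_quot_ge: "regular_seq K V I fs \<Longrightarrow> enat (length fs) \<le> depth_quot K V I"
  unfolding depth_quot_def by (intro Sup_upper) blast

lemma depth_quot_le:
  assumes "\<And>fs. regular_seq K V I fs \<Longrightarrow> enat (length fs) \<le> d"
  shows "depth_quot K V I \<le> d"
  unfolding depth_quot_def using assms by (intro Sup_least) auto

lemma depth_quot_le_krull_dim_quot: "I \<subseteq> polys K V \<Longrightarrow> depth_quot K V I \<le> krull_dim_quot K V I"
  by (intro depth_quot_le length_regular_seq_le_krull_dim_quot)

section \<open>Monomial ideals\<close>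

definition upward_closed :: "(('v \<Rightarrow>\<^sub>0 nat) \<Rightarrow> bool) \<Rightarrow> bool" where
  "upward_closed Q \<longleftrightarrow> (\<forall>k l. Q k \<longrightarrow> Q (l + k))"

definition monomial_ideal ::
    "'k::field itself \<Rightarrow> 'v set \<Rightarrow> (('v \<Rightarrow>\<^sub>0 nat) \<Rightarrow> bool) \<Rightarrow> ('v, 'k) mpoly set" where
  "monomial_ideal K V Q = {p \<in> polys K V. \<forall>k\<in>keys p. Q k}"

lemma monomial_idealI: "p \<in> polys K V \<Longrightarrow> (\<And>k. k \<in> keys p \<Longrightarrow> Q k) \<Longrightarrow> p \<in> monomial_ideal K V Q"
  by (simp add: monomial_ideal_def)

lemma monomial_idealD: "p \<in> monomial_ideal K V Q \<Longrightarrow> k \<in> keys p \<Longrightarrow> Q k"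
  by (simp add: monomial_ideal_def)

lemma monomial_ideal_polys: "p \<in> monomial_ideal K V Q \<Longrightarrow> p \<in> polys K V"
  by (simp add: monomial_ideal_def)

lemma is_ideal_monomial_ideal:
  assumes Q: "upward_closed Q"
  shows "is_ideal K V (monomial_ideal K V Q)"
  unfolding is_ideal_def
proof (intro conjI ballI)
  fix p q assume "p \<in> monomial_ideal K V Q" "q \<in> monomial_ideal K V Q"
  then show "p + q \<in> monomial_ideal K V Q"
    using keys_add[of p q] unfolding monomial_ideal_def by blast
next
  fix r p assume "r \<in> polys K V" "p \<in> monomial_ideal K V Q"
  then show "r * p \<in> monomial_ideal K V Q"
    using Q by (auto simp: monomial_ideal_def upward_closed_def elim!: keys_multE)
qed (auto simp: monomial_ideal_def)

lemma monomial_ideal_subset: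
  assumes J: "is_ideal K V J"
    and monomials: "\<And>k. Q k \<Longrightarrow> keys k \<subseteq> V \<Longrightarrow> single k 1 \<in> J"
  shows "monomial_ideal K V Q \<subseteq> J"
proof
  fix p assume p: "p \<in> monomial_ideal K V Q"
  have "single k (lookup p k) \<in> J" if "k \<in> keys p" for k
  proof -
    have "single 0 (lookup p k) * single k 1 \<in> J"
      using p that by (intro is_idealD(4)[OF J] monomials polys_const)
        (auto simp: monomial_ideal_def dest: polysD)
    then show ?thesis by (simp add: mult_single)
  qed
  then have "(\<Sum>k\<in>keys p. single k (lookup p k)) \<in> J"
    by (rule is_ideal_sum[OF J])
  then show "p \<in> J" by (simp add: poly_mapping_sum_single)
qed

lemma upward_closed_meets: "upward_closed (\<lambda>k. keys k \<inter> X \<noteq> {})"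
  by (auto simp: upward_closed_def keys_plus_nat)

lemma vars_ideal_eq:
  assumes "X \<subseteq> V"
  shows "vars_ideal K V X = monomial_ideal K V (\<lambda>k. keys k \<inter> X \<noteq> {})"
proof
  show "vars_ideal K V X \<subseteq> monomial_ideal K V (\<lambda>k. keys k \<inter> X \<noteq> {})"
    using assms by (intro gen_ideal_least is_ideal_monomial_ideal upward_closed_meets)
      (auto intro!: monomial_idealI)
  have I: "is_ideal K V (vars_ideal K V X)"
    using assms by (intro is_ideal_gen_ideal) auto
  show "monomial_ideal K V (\<lambda>k. keys k \<inter> X \<noteq> {}) \<subseteq> vars_ideal K V X"
  proof (rule monomial_ideal_subset[OF I])
    fix k :: "'a \<Rightarrow>\<^sub>0 nat" assume k: "keys k \<inter> X \<noteq> {}" "keys k \<subseteq> V"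
    then obtain v where v: "v \<in> keys k" "v \<in> X" by blast
    then have "single v 1 adds k" by (simp only: single_1_adds_iff)
    then obtain l where l: "k = single v 1 + l" by (rule addsE)
    have "single l 1 * var v \<in> vars_ideal K V X"
      using k(2) v(2) by (intro is_idealD(4)[OF I] polys_single gen_ideal_base)
        (auto simp: l keys_plus_nat)
    then show "single k 1 \<in> vars_ideal K V X"
      by (simp add: l var_def mult_single add.commute)
  qed
qed

lemma regular_mod_monomial_ideal_var:
  assumes "\<And>w. Q (single b 1 + w) \<Longrightarrow> Q w"
  shows "regular_mod K V (monomial_ideal K V Q) (var b)"
  unfolding regular_mod_def
proof (intro ballI impI)
  fix g assume g: "g \<in> polys K V" "var b * g \<in> monomial_ideal K V Q"
  show "g \<in> monomial_ideal K V Q"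
  proof (rule monomial_idealI[OF g(1)])
    fix w assume "w \<in> keys g"
    then have "single b 1 + w \<in> keys (var b * g)"
      by (simp add: in_keys_iff lookup_var_mult lookup_add)
    then show "Q w" using monomial_idealD[OF g(2)] assms by blast
  qed
qed

lemma regular_seq_vars:
  assumes "X \<subseteq> V" "distinct bs" "set bs \<subseteq> V - X"
  shows "regular_seq K V (var ` X) (map var bs)"
proof -
  have gen: "gen_ideal K V (var ` X \<union> var ` set as) =
      monomial_ideal K V (\<lambda>k. keys k \<inter> (X \<union> set as) \<noteq> {})" if "set as \<subseteq> set bs" for as
    using that assms(1,3) by (subst image_Un[symmetric], intro vars_ideal_eq) blast
  have "weakly_regular_seq K V (var ` X) (map var as)" if "set as \<subseteq> set bs" "distinct as" for as
    using that
  proof (induction as rule: rev_induct)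
    case (snoc b as)
    have "regular_mod K V (monomial_ideal K V (\<lambda>k. keys k \<inter> (X \<union> set as) \<noteq> {})) (var b)"
      using snoc.prems assms(3) by (intro regular_mod_monomial_ideal_var) (auto simp: keys_plus_nat)
    then show ?case
      using snoc by (simp add: gen)
  qed simp
  moreover have "1 \<notin> gen_ideal K V (var ` X \<union> var ` set bs)"
    unfolding gen[OF subset_refl] by (simp add: monomial_ideal_def)
  ultimately show ?thesis
    using assms(2,3) by (auto simp: regular_seq_iff var_in_max_hom_ideal)
qed

lemma monomial_ideal_var_diff_shift:
  fixes K :: "'k::field itself"
  assumes product: "(var a - var b) * g \<in> monomial_ideal K V Q"
    and mixed: "\<And>w. a \<in> keys w \<Longrightarrow> b \<in> keys w \<Longrightarrow> Q w" and w: "w \<in> keys g"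
  shows "Q (single a 1 + w)"
proof (rule ccontr)
  assume not_Q: "\<not> Q (single a 1 + w)"
  then have "b \<notin> keys (single a 1 + w)"
    using mixed by (auto simp: keys_plus_nat)
  then have "lookup ((var a - var b) * g) (single a 1 + w) = lookup g w"
    by (simp add: left_diff_distrib lookup_minus lookup_var_mult keys_plus_nat)
  then have "single a 1 + w \<in> keys ((var a - var b) * g)"
    using w by (simp add: in_keys_iff)
  then show False using monomial_idealD[OF product] not_Q by blast
qed

lemma regular_mod_monomial_ideal_var_diff:
  fixes K :: "'k::field itself"
  assumes Q: "upward_closed Q"
    and mixed: "\<And>w. a \<in> keys w \<Longrightarrow> b \<in> keys w \<Longrightarrow> Q w"
    and saturated: "\<And>w. Q (single a 1 + w) \<Longrightarrow> Q (single b 1 + w) \<Longrightarrow> Q w"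
  shows "regular_mod K V (monomial_ideal K V Q) (var a - var b)"
  unfolding regular_mod_def
proof (intro ballI impI)
  fix g assume g: "g \<in> polys K V" "(var a - var b) * g \<in> monomial_ideal K V Q"
  have "(var b - var a) * g \<in> monomial_ideal K V Q"
    using is_ideal_uminus[OF is_ideal_monomial_ideal[OF Q] g(2)] by (simp add: left_diff_distrib)
  then have "Q (single a 1 + w) \<and> Q (single b 1 + w)" if "w \<in> keys g" for w
    using monomial_ideal_var_diff_shift[OF g(2) mixed that]
      monomial_ideal_var_diff_shift[of b a g K V Q w] mixed that by blast
  then show "g \<in> monomial_ideal K V Q"
    using g(1) saturated by (intro monomial_idealI) blast+
qed

lemma mono_deg_superset:
  assumes "finite S" "keys m \<subseteq> S"
  shows "mono_deg m = (\<Sum>v\<in>S. lookup m v)"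
  unfolding mono_deg_def using assms by (intro sum.mono_neutral_left) (auto simp: in_keys_iff)

lemma mono_deg_add: "mono_deg (m + n) = mono_deg m + mono_deg n"
  by (simp add: mono_deg_superset[of "keys m \<union> keys n"] keys_plus_nat lookup_add sum.distrib)

lemma mono_deg_eq_0_iff: "mono_deg m = 0 \<longleftrightarrow> m = 0"
  by (auto simp: mono_deg_def in_keys_iff intro!: poly_mapping_eqI)

lemma mono_deg_1E:
  assumes "mono_deg v = 1"
  obtains t where "v = single t 1"
proof -
  have "v \<noteq> 0" using assms mono_deg_eq_0_iff[of v] by simp
  then obtain t where "t \<in> keys v" using keys_eq_empty[of v] by blast
  then obtain l where l: "v = single t 1 + l"
    using single_1_adds_iff addsE by metis
  then have "mono_deg l = 0" using assms by (simp add: mono_deg_add mono_deg_def[of "single t _"])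
  then show thesis using that l by (simp add: mono_deg_eq_0_iff)
qed

text \<open>Among the monomials of \<open>g\<close> outside the ideal, one of least degree survives in \<open>f * g\<close>.\<close>

lemma regular_mod_monomial_ideal_if_const_coeff:
  fixes f :: "('v, 'k::field) mpoly"
  assumes Q: "upward_closed Q" and f: "lookup f 0 \<noteq> 0"
  shows "regular_mod K V (monomial_ideal K V Q) f"
  unfolding regular_mod_def
proof (intro ballI impI)
  fix g assume g: "g \<in> polys K V" "f * g \<in> monomial_ideal K V Q"
  show "g \<in> monomial_ideal K V Q"
  proof (rule ccontr)
    assume "g \<notin> monomial_ideal K V Q"
    then have "\<exists>w. w \<in> keys g \<and> \<not> Q w"
      using g(1) by (auto simp: monomial_ideal_def)
    then obtain w where w: "w \<in> keys g" "\<not> Q w"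
      and least: "\<And>v. v \<in> keys g \<Longrightarrow> \<not> Q v \<Longrightarrow> mono_deg w \<le> mono_deg v"
      using ex_has_least_nat[of "\<lambda>w. w \<in> keys g \<and> \<not> Q w" _ mono_deg] by blast
    define f' where "f' = f - single 0 (lookup f 0)"
    have "w \<notin> keys (f' * g)"
    proof
      assume "w \<in> keys (f' * g)"
      then obtain u v where uv: "w = u + v" "u \<in> keys f'" "v \<in> keys g" by (rule keys_multE)
      have "u \<noteq> 0" using uv(2) by (auto simp: f'_def in_keys_iff lookup_minus)
      then have "mono_deg v < mono_deg w"
        using mono_deg_eq_0_iff[of u] by (simp add: uv(1) mono_deg_add)
      moreover have "\<not> Q v"
        using Q w(2) by (auto simp: uv(1) upward_closed_def)
      ultimately show False using least[OF uv(3)] by simp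
    qed
    moreover have "f * g = single 0 (lookup f 0) * g + f' * g"
      by (simp add: f'_def algebra_simps)
    ultimately have "lookup (f * g) w = lookup f 0 * lookup g w"
      by (simp add: lookup_add lookup_single_mult adds_def in_keys_iff)
    then show False
      using f w monomial_idealD[OF g(2), of w] by (simp add: in_keys_iff)
  qed
qed

lemma regular_mod_vars_ideal_if_const_coeff:
  fixes f :: "('v, 'k::field) mpoly"
  assumes "X \<subseteq> V" "lookup f 0 \<noteq> 0"
  shows "regular_mod K V (vars_ideal K V X) f"
  unfolding vars_ideal_eq[OF assms(1)]
  by (rule regular_mod_monomial_ideal_if_const_coeff[OF upward_closed_meets assms(2)])

section \<open>Chains of primes in polynomial rings\<close>

lemma power_sum_coeffs_eq_0:
  fixes x :: "('v, 'k::field) mpoly"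
  assumes P: "is_prime_ideal K V P" and P': "is_ideal K V P'" "P \<subseteq> P'"
    and x: "x \<in> P' - P" and "\<And>p. g p \<in> polys K V"
    and "\<And>p. p \<le> N \<Longrightarrow> g p \<in> P' \<Longrightarrow> g p = 0"
    and "(\<Sum>p\<le>N. x ^ p * g p) \<in> P" and "p \<le> N"
  shows "g p = 0"
  using assms(5-)
proof (induction N arbitrary: g p)
  case 0
  then show ?case using P'(2) by auto
next
  case (Suc N)
  let ?tail = "\<Sum>p\<le>N. x ^ p * g (Suc p)"
  have x_polys: "x \<in> polys K V" using x is_idealD(1)[OF P'(1)] by blast
  then have tail: "?tail \<in> polys K V"
    using Suc.prems(1) by (intro polys_sum polys_mult polys_power)
  have split: "(\<Sum>p\<le>Suc N. x ^ p * g p) = x * ?tail + g 0"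
    by (simp add: sum.atMost_Suc_shift sum_distrib_left mult.assoc add.commute del: sum.atMost_Suc)
  have sum_in_P: "x * ?tail + g 0 \<in> P"
    using Suc.prems(3) by (simp only: split)
  have "x * ?tail \<in> P'"
    using x tail by (intro is_ideal_mult_right[OF P'(1)]) auto
  then have "g 0 \<in> P'"
    using is_ideal_add_cancel_left[OF P'(1)] sum_in_P P'(2) by blast
  then have "g 0 = 0"
    using Suc.prems(2)[of 0] by simp
  then have tail_in_P: "?tail \<in> P"
    using is_prime_idealD(3)[OF P x_polys tail] sum_in_P x by auto
  have "g (Suc q) = 0" if "q \<le> N" for q
    by (rule Suc.IH[of "\<lambda>p. g (Suc p)"]) (use Suc.prems(1,2) that tail_in_P in auto)
  then show ?case
    using \<open>g 0 = 0\<close> Suc.prems(4) by (metis Suc_le_mono not0_implies_Suc)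
qed

primrec power_product :: "(nat \<Rightarrow> 'a::comm_monoid_mult) \<Rightarrow> nat list \<Rightarrow> 'a" where
  "power_product x [] = 1"
| "power_product x (e # es) = x 0 ^ e * power_product (\<lambda>i. x (Suc i)) es"

lemma power_product_polys:
  "(\<And>i. i < length es \<Longrightarrow> x i \<in> polys K V) \<Longrightarrow> power_product x es \<in> polys K V"
  by (induction es arbitrary: x) (simp_all add: polys_mult polys_power)

lemma sum_lists_length_Suc:
  "(\<Sum>es\<in>{es. set es \<subseteq> A \<and> length es = Suc m}. f es) =
     (\<Sum>e\<in>A. \<Sum>es\<in>{es. set es \<subseteq> A \<and> length es = m}. f (e # es))"
proof -
  have "(\<Sum>es\<in>{es. set es \<subseteq> A \<and> length es = Suc m}. f es) =
      (\<Sum>(es, e)\<in>{es. set es \<subseteq> A \<and> length es = m} \<times> A. f (e # es))"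
    unfolding lists_length_Suc_eq
    by (subst sum.reindex) (auto simp: inj_on_def intro!: sum.cong)
  then show ?thesis
    by (simp add: sum.cartesian_product[symmetric] sum.swap[of _ A])
qed

lemma prime_chain_power_products_independent:
  fixes x :: "nat \<Rightarrow> ('v, 'k::field) mpoly"
  assumes "prime_chain K V I P m" and "\<And>i. i < m \<Longrightarrow> x i \<in> P (Suc i) - P i"
    and "(\<Sum>es\<in>{es. set es \<subseteq> {..N} \<and> length es = m}. single 0 (c es) * power_product x es) \<in> P 0"
    and "set es \<subseteq> {..N}" "length es = m"
  shows "c es = 0"
  using assms
proof (induction m arbitrary: x P c es)
  case 0
  have "{es. set es \<subseteq> {..N} \<and> length es = 0} = {[]}" by auto
  then have "single 0 (c []) \<in> P 0" using "0.prems"(3) by simp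
  then show ?case
    using const_in_prime_ideal_iff[of K V "P 0"] "0.prems"(1,5) by (simp add: prime_chain_def)
next
  case (Suc m)
  let ?tails = "{es. set es \<subseteq> {..N} \<and> length es = m}"
  define g where "g e = (\<Sum>es\<in>?tails. single 0 (c (e # es)) * power_product (\<lambda>i. x (Suc i)) es)" for e
  have prime: "is_prime_ideal K V (P i)" if "i \<le> Suc m" for i
    using Suc.prems(1) that by (simp add: prime_chain_def)
  note ideal = is_prime_idealD(1)[OF prime]
  have "x i \<in> polys K V" if "i \<le> m" for i
    using Suc.prems(2)[of i] is_idealD(1)[OF ideal[of "Suc i"]] that by auto
  then have g_polys: "g e \<in> polys K V" for e
    unfolding g_def by (intro polys_sum polys_mult power_product_polys polys_const) auto
  have tail_chain: "prime_chain K V I (\<lambda>i. P (Suc i)) m"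
    using Suc.prems(1) by (simp add: prime_chain_def)
  have coeffs: "c (e # es) = 0" if "g e \<in> P (Suc 0)" "es \<in> ?tails" for e es
    using Suc.IH[OF tail_chain, of "\<lambda>i. x (Suc i)" "\<lambda>es. c (e # es)" es] Suc.prems(2) that
    by (simp add: g_def)
  then have g_eq_0: "g e = 0" if "g e \<in> P (Suc 0)" for e
    using coeffs[OF that] by (simp add: g_def)
  have "(\<Sum>e\<le>N. x 0 ^ e * g e) \<in> P 0"
    using Suc.prems(3) by (simp add: sum_lists_length_Suc g_def sum_distrib_left mult_ac)
  moreover have "P 0 \<subseteq> P (Suc 0)" "x 0 \<in> P (Suc 0) - P 0"
    using Suc.prems(1) Suc.prems(2)[of 0] by (auto simp: prime_chain_def)
  ultimately have "g e = 0" if "e \<le> N" for e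
    using power_sum_coeffs_eq_0[OF prime ideal _ _ g_polys g_eq_0, of 0 "Suc 0"] that by simp
  moreover obtain e es' where "es = e # es'" using Suc.prems(5) by (cases es) auto
  ultimately show ?case
    using coeffs[of e es'] Suc.prems(4,5) is_idealD(2)[OF ideal[of "Suc 0"]] by auto
qed

definition exps_le :: "nat \<Rightarrow> ('v, 'k::zero) mpoly \<Rightarrow> bool" where
  "exps_le d p \<longleftrightarrow> (\<forall>m\<in>keys p. \<forall>v. lookup m v \<le> d)"

lemma exps_le_mono: "exps_le d p \<Longrightarrow> d \<le> e \<Longrightarrow> exps_le e p"
  unfolding exps_le_def using le_trans by blast

lemma exps_le_one: "exps_le d 1"
  by (simp add: exps_le_def)

lemma exps_le_mult: "exps_le d p \<Longrightarrow> exps_le e q \<Longrightarrow> exps_le (d + e) (p * q)"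
  unfolding exps_le_def by (auto elim!: keys_multE simp: lookup_add add_mono)

lemma exps_le_power: "exps_le d p \<Longrightarrow> exps_le (n * d) (p ^ n)"
  by (induction n) (auto intro: exps_le_mult exps_le_one)

lemma exps_le_power_product:
  "(\<And>i. i < length es \<Longrightarrow> exps_le d (x i)) \<Longrightarrow> exps_le (sum_list es * d) (power_product x es)"
proof (induction es arbitrary: x)
  case (Cons e es)
  have "exps_le (e * d) (x 0 ^ e)"
    using Cons.prems[of 0] by (intro exps_le_power) simp
  moreover have "exps_le (sum_list es * d) (power_product (\<lambda>i. x (Suc i)) es)"
    using Cons.prems by (intro Cons.IH) simp
  ultimately show ?case
    by (simp add: distrib_right exps_le_mult)
qed (simp add: exps_le_one)

lemma keys_power_product_subset:
  assumes x: "\<And>i. i < length es \<Longrightarrow> x i \<in> polys K U" "\<And>i. i < length es \<Longrightarrow> exps_le d (x i)"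
    and es: "set es \<subseteq> {..N}"
  shows "keys (power_product x es) \<subseteq> {k. keys k \<subseteq> U \<and> (\<forall>v. lookup k v \<le> length es * d * N)}"
proof -
  have "sum_list es \<le> length es * N"
    using sum_list_mono[of es id "\<lambda>_. N"] es by (auto simp: sum_list_triv)
  then have "sum_list es * d \<le> length es * d * N"
    using mult_le_mono1[of "sum_list es" "length es * N" d] by (simp add: mult_ac)
  then have "exps_le (length es * d * N) (power_product x es)"
    using exps_le_mono[OF exps_le_power_product[of es d x]] x(2) by metis
  moreover have "power_product x es \<in> polys K U"
    by (rule power_product_polys) (rule x(1))
  ultimately show ?thesis
    by (auto simp: exps_le_def dest: polysD)
qed

lemma exps_le_uniform:
  assumes "finite A"
  obtains d where "\<And>i. i \<in> A \<Longrightarrow> exps_le d (f i)"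
proof -
  have "finite (\<Union>i\<in>A. \<Union>m\<in>keys (f i). lookup m ` keys m)" using assms by auto
  then obtain d where "\<forall>n\<in>(\<Union>i\<in>A. \<Union>m\<in>keys (f i). lookup m ` keys m). n \<le> d"
    by (auto simp: finite_nat_set_iff_bounded_le)
  then have "lookup m v \<le> d" if "i \<in> A" "m \<in> keys (f i)" for i m v
    using that by (cases "v \<in> keys m") (auto simp: in_keys_iff)
  then show thesis using that unfolding exps_le_def by blast
qed

lemma card_bounded_exponents_le:
  fixes U :: "'v set" and d :: nat
  assumes U: "finite U"
  defines "B \<equiv> {m. keys m \<subseteq> U \<and> (\<forall>v. lookup m v \<le> d)}"
  shows "finite B" "card B \<le> (d + 1) ^ card U"
proof -
  have fin: "finite (U \<rightarrow>\<^sub>E {..d})" using U by (intro finite_PiE) auto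
  have inj: "inj_on (\<lambda>m. restrict (lookup m) U) B"
  proof (rule inj_onI)
    fix m n assume mn: "m \<in> B" "n \<in> B" "restrict (lookup m) U = restrict (lookup n) U"
    have "lookup m v = lookup n v" for v
    proof (cases "v \<in> U")
      case True
      then show ?thesis using fun_cong[OF mn(3), of v] by simp
    next
      case False
      then have "v \<notin> keys m" "v \<notin> keys n" using mn by (auto simp: B_def)
      then show ?thesis by (simp add: in_keys_iff)
    qed
    then show "m = n" by (rule poly_mapping_eqI)
  qed
  have image: "(\<lambda>m. restrict (lookup m) U) ` B \<subseteq> (U \<rightarrow>\<^sub>E {..d})"
    by (auto simp: B_def)
  show "finite B" by (rule inj_on_finite[OF inj image fin])
  show "card B \<le> (d + 1) ^ card U"
    using card_inj_on_le[OF inj image fin] U by (simp add: card_PiE)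
qed

lemma (in vector_space) card_le_if_independent_family:
  assumes I: "finite I" and T: "finite T" and span: "f ` I \<subseteq> span T"
    and independent: "\<And>c i. (\<Sum>i\<in>I. scale (c i) (f i)) = 0 \<Longrightarrow> i \<in> I \<Longrightarrow> c i = 0"
  shows "card I \<le> card T"
proof -
  have inj: "inj_on f I"
  proof (rule inj_onI, rule ccontr)
    fix i j assume ij: "i \<in> I" "j \<in> I" "f i = f j" "i \<noteq> j"
    define c where "c = (\<lambda>l. if l = i then 1 else if l = j then - 1 else 0 :: 'a)"
    have "(\<Sum>l\<in>I. scale (c l) (f l)) = (\<Sum>l\<in>{i, j}. scale (c l) (f l))"
      using ij I by (intro sum.mono_neutral_right) (auto simp: c_def)
    also have "\<dots> = 0" using ij by (simp add: c_def)
    finally show False using independent[of c i] ij(1) by (simp add: c_def)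
  qed
  have "\<not> dependent (f ` I)"
  proof
    assume "dependent (f ` I)"
    then obtain u where "\<exists>v\<in>f ` I. u v \<noteq> 0" "(\<Sum>v\<in>f ` I. scale (u v) v) = 0"
      using dependent_finite[of "f ` I"] I by auto
    then show False
      using independent[of "\<lambda>i. u (f i)"] by (auto simp: sum.reindex[OF inj])
  qed
  then show ?thesis
    using independent_span_bound[OF T _ span] by (simp add: card_image[OF inj])
qed

lemma vector_space_mpoly: "vector_space (\<lambda>(c::'k::field) (p :: ('v, 'k) mpoly). single 0 c * p)"
  by unfold_locales (auto simp: algebra_simps single_add mult_single mult.assoc[symmetric])

lemma mpoly_in_span_monomials:
  fixes p :: "('v, 'k::field) mpoly"
  assumes "keys p \<subseteq> B"
  shows "p \<in> module.span (\<lambda>c p. single 0 c * p) ((\<lambda>k. single k 1) ` B)"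
proof -
  interpret vs: vector_space "\<lambda>(c::'k) (p :: ('v, 'k) mpoly). single 0 c * p"
    by (rule vector_space_mpoly)
  have "(\<Sum>k\<in>keys p. single 0 (lookup p k) * single k 1) \<in> vs.span ((\<lambda>k. single k 1) ` B)"
    using assms by (intro vs.span_sum vs.span_scale vs.span_base) auto
  then show ?thesis by (simp add: mult_single poly_mapping_sum_single)
qed

lemma power_le_linear_power_imp_le:
  fixes k m n :: nat
  assumes "\<And>N. (N + 1) ^ m \<le> (k * N + 1) ^ n"
  shows "m \<le> n"
proof (rule ccontr)
  assume "\<not> m \<le> n"
  define N where "N = (k + 1) ^ n"
  have "(N + 1) ^ Suc n \<le> (N + 1) ^ m" using \<open>\<not> m \<le> n\<close> by (intro power_increasing) auto
  also have "\<dots> \<le> (k * N + 1) ^ n" by (rule assms)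
  also have "\<dots> \<le> ((k + 1) * (N + 1)) ^ n" by (intro power_mono) (auto simp: algebra_simps)
  also have "\<dots> = N * (N + 1) ^ n" unfolding N_def by (rule power_mult_distrib)
  finally show False by simp
qed

lemma reduce_mod_vars:
  assumes I: "is_ideal K V I" and C: "var ` C \<subseteq> I" "C \<subseteq> V" and f: "f \<in> polys K V"
  obtains g where "g \<in> polys K (V - C)" "f - g \<in> I"
proof -
  define g where "g = (\<Sum>k\<in>{k\<in>keys f. keys k \<inter> C = {}}. single k (lookup f k))"
  define r where "r = (\<Sum>k\<in>{k\<in>keys f. keys k \<inter> C \<noteq> {}}. single k (lookup f k))"
  have "keys r \<subseteq> {k\<in>keys f. keys k \<inter> C \<noteq> {}}"
    unfolding r_def by (rule order.trans[OF keys_sum]) (auto split: if_splits)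
  then have "r \<in> vars_ideal K V C"
    unfolding vars_ideal_eq[OF C(2)] using polysD[OF f] by (intro monomial_idealI polysI) blast+
  then have "r \<in> I" using gen_ideal_least[OF I C(1)] by blast
  moreover have "f = g + r"
    unfolding g_def r_def
    by (subst poly_mapping_sum_single[of f, symmetric], subst sum.union_disjoint[symmetric])
       (auto intro!: sum.cong)
  moreover have "g \<in> polys K (V - C)"
    unfolding g_def using polysD[OF f] by (intro polys_sum polys_single) blast
  ultimately show thesis using that[of g] by simp
qed

lemma prime_chain_witnesses:
  assumes chain: "prime_chain K V I P m" and C: "var ` C \<subseteq> I" "C \<subseteq> V"
  obtains x where "\<And>i. i < m \<Longrightarrow> x i \<in> polys K (V - C)" "\<And>i. i < m \<Longrightarrow> x i \<in> P (Suc i) - P i"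
proof -
  have ideal: "is_ideal K V (P i)" and I: "I \<subseteq> P i" if "i \<le> m" for i
    using chain that by (auto simp: prime_chain_def is_prime_ideal_def)
  have "\<exists>g. g \<in> polys K (V - C) \<and> g \<in> P (Suc i) - P i" if i: "i < m" for i
  proof -
    have sub: "P i \<subset> P (Suc i)" using chain i by (simp add: prime_chain_def)
    then obtain f where f: "f \<in> P (Suc i)" "f \<notin> P i" by blast
    have "f \<in> polys K V" using f(1) is_idealD(1)[OF ideal[of "Suc i"]] i by auto
    then obtain g where g: "g \<in> polys K (V - C)" "f - g \<in> P i"
      using reduce_mod_vars[OF ideal[of i] _ C(2)] C(1) I[of i] i by (metis less_imp_le order.trans)
    have "g \<notin> P i"
      using is_idealD(3)[OF ideal g(2), of g] i f(2) by auto
    moreover have "g \<in> P (Suc i)"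
      using is_ideal_diff[OF ideal f(1), of "f - g"] g(2) sub i by auto
    ultimately show ?thesis using g(1) by blast
  qed
  then show thesis using that by metis
qed

text \<open>The products of powers of the witnesses with exponents up to \<open>N\<close> are linearly independent,
  but they involve only monomials whose number grows like \<open>N ^ card (V - C)\<close>.\<close>

lemma prime_chain_length_le:
  fixes K :: "'k::field itself" and V :: "'v set"
  assumes chain: "prime_chain K V I P m" and C: "var ` C \<subseteq> I" "C \<subseteq> V" and V: "finite V"
  shows "m \<le> card (V - C)"
proof -
  interpret vs: vector_space "\<lambda>(c::'k) (p :: ('v, 'k) mpoly). single 0 c * p"
    by (rule vector_space_mpoly)
  obtain x where x_polys: "\<And>i. i < m \<Longrightarrow> x i \<in> polys K (V - C)"
    and x: "\<And>i. i < m \<Longrightarrow> x i \<in> P (Suc i) - P i"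
    using prime_chain_witnesses[OF chain C] by metis
  obtain D where D: "\<And>i. i \<in> {..<m} \<Longrightarrow> exps_le D (x i)"
    using exps_le_uniform[OF finite_lessThan] by metis
  have "0 \<in> P 0"
    using chain by (auto simp: prime_chain_def is_prime_ideal_def is_ideal_def)
  have "(N + 1) ^ m \<le> (m * D * N + 1) ^ card (V - C)" for N
  proof -
    define L where "L = {es. set es \<subseteq> {..N} \<and> length es = m}"
    define B where "B = {k. keys k \<subseteq> V - C \<and> (\<forall>v. lookup k v \<le> m * D * N)}"
    have B: "finite B" "card B \<le> (m * D * N + 1) ^ card (V - C)"
      unfolding B_def using card_bounded_exponents_le[of "V - C"] V by auto
    have "keys (power_product x es) \<subseteq> B" if "es \<in> L" for es
      using keys_power_product_subset[of es x K "V - C" D N] x_polys D that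
      by (simp add: L_def B_def)
    then have span: "power_product x ` L \<subseteq> vs.span ((\<lambda>k. single k 1) ` B)"
      using mpoly_in_span_monomials by blast
    have independent: "c es = 0"
      if "(\<Sum>es\<in>L. single 0 (c es) * power_product x es) = 0" "es \<in> L" for c es
      using prime_chain_power_products_independent[OF chain x, of c N es] \<open>0 \<in> P 0\<close> that
      by (simp add: L_def)
    have "card L \<le> card ((\<lambda>k. single k (1::'k)) ` B)"
      using finite_lists_length_eq[of "{..N}" m] B(1) span independent
      by (intro vs.card_le_if_independent_family[of L _ "power_product x"]) (auto simp: L_def)
    also have "\<dots> \<le> card B" by (rule card_image_le[OF B(1)])
    finally show ?thesis
      using B(2) card_lists_length_eq[of "{..N}" m] by (simp add: L_def)
  qed
  then show ?thesis by (rule power_le_linear_power_imp_le)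
qed

section \<open>Minimal vertex covers\<close>

lemma vertex_coverD: "is_vertex_cover V E C \<Longrightarrow> {x, y} \<in> E \<Longrightarrow> x \<notin> C \<Longrightarrow> y \<in> C"
  by (auto simp: is_vertex_cover_def)

lemma min_vertex_coverD:
  assumes "min_vertex_cover V E C"
  shows "is_vertex_cover V E C" "C \<subseteq> V" "{x, y} \<in> E \<Longrightarrow> x \<notin> C \<Longrightarrow> y \<in> C"
  using assms by (auto simp: min_vertex_cover_def is_vertex_cover_def)

lemma min_vertex_coverI:
  assumes "is_vertex_cover V E C" "\<And>x. x \<in> C \<Longrightarrow> \<exists>y. {x, y} \<in> E \<and> y \<notin> C"
  shows "min_vertex_cover V E C"
  unfolding min_vertex_cover_def
proof (intro conjI allI impI notI)
  fix D assume D: "D \<subset> C" "is_vertex_cover V E D"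
  then obtain x where x: "x \<in> C" "x \<notin> D" by blast
  then obtain y where "{x, y} \<in> E" "y \<notin> C" using assms(2) by blast
  then show False using vertex_coverD[OF D(2)] x D(1) by blast
qed (rule assms(1))

definition complete_between :: "'v set set \<Rightarrow> 'v set \<Rightarrow> 'v set \<Rightarrow> bool" where
  "complete_between E A B \<longleftrightarrow> (\<forall>a\<in>A. \<forall>b\<in>B. {a, b} \<in> E)"

definition thin_complete_pairs :: "'v set \<Rightarrow> 'v set set \<Rightarrow> bool" where
  "thin_complete_pairs V E \<longleftrightarrow> (\<forall>C D. min_vertex_cover V E C \<and> min_vertex_cover V E D \<and>
     complete_between E (C - D) (D - C) \<longrightarrow> card (C - D) \<le> 1)"

lemma thin_complete_pairs_nonadjacent:
  assumes "thin_complete_pairs V E" "min_vertex_cover V E C" "min_vertex_cover V E D"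
    and "card (C - D) > 1"
  obtains a b where "a \<in> C - D" "b \<in> D - C" "{a, b} \<notin> E"
  using assms unfolding thin_complete_pairs_def complete_between_def by (meson leD)

locale finite_graph =
  fixes V :: "'v set" and E :: "'v set set"
  assumes simple: "simple_graph V E"
begin

lemma finite_vertices: "finite V"
  using simple by (simp add: simple_graph_def)

lemma edge_neq: "{x, y} \<in> E \<Longrightarrow> x \<noteq> y"
  using simple unfolding simple_graph_def by fastforce

lemma edge_in: "{x, y} \<in> E \<Longrightarrow> x \<in> V \<and> y \<in> V"
  using simple unfolding simple_graph_def by blast

lemma vertex_coverI:
  assumes "C \<subseteq> V" "\<And>x y. {x, y} \<in> E \<Longrightarrow> x \<notin> C \<Longrightarrow> y \<in> C"
  shows "is_vertex_cover V E C"
  unfolding is_vertex_cover_def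
proof (intro conjI ballI)
  fix e assume e: "e \<in> E"
  then have "card e = 2" using simple by (simp add: simple_graph_def)
  then obtain x y where "e = {x, y}" by (auto simp: card_2_iff)
  then show "e \<inter> C \<noteq> {}" using assms(2)[of x y] e by blast
qed (rule assms(1))

lemma finite_min_vertex_cover: "min_vertex_cover V E C \<Longrightarrow> finite C"
  using finite_vertices min_vertex_coverD(2) finite_subset by metis

lemma finite_min_vertex_covers: "finite {C. min_vertex_cover V E C}"
  using finite_vertices by (auto intro: finite_subset[of _ "Pow V"] dest: min_vertex_coverD(2))

lemma min_vertex_cover_neighbour:
  assumes C: "min_vertex_cover V E C" and x: "x \<in> C"
  obtains y where "{x, y} \<in> E" "y \<notin> C"
proof -
  have "\<not> is_vertex_cover V E (C - {x})"
    using C x unfolding min_vertex_cover_def by blast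
  then obtain a b where ab: "{a, b} \<in> E" "a \<notin> C - {x}" "b \<notin> C - {x}"
    using vertex_coverI[of "C - {x}"] min_vertex_coverD(2)[OF C] by blast
  then have "{b, a} \<in> E" "a \<noteq> b"
    using edge_neq by (auto simp: insert_commute)
  then show thesis
    using ab min_vertex_coverD(3)[OF C] that[of a] that[of b] by blast
qed

lemma min_vertex_cover_below:
  assumes "is_vertex_cover V E C"
  obtains D where "D \<subseteq> C" "min_vertex_cover V E D"
proof -
  have "finite {D. D \<subseteq> C \<and> is_vertex_cover V E D}"
    using finite_vertices by (auto simp: is_vertex_cover_def intro: finite_subset[of _ "Pow V"])
  then obtain D where D: "D \<subseteq> C" "is_vertex_cover V E D"
    and "\<And>D'. D' \<subseteq> C \<and> is_vertex_cover V E D' \<Longrightarrow> D' \<subseteq> D \<Longrightarrow> D = D'"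
    using finite_has_minimal2[of "{D. D \<subseteq> C \<and> is_vertex_cover V E D}" C] assms by auto
  then have "min_vertex_cover V E D" unfolding min_vertex_cover_def by blast
  then show thesis using that D by blast
qed

lemma min_vertex_cover_avoiding:
  assumes C: "min_vertex_cover V E C" and D: "min_vertex_cover V E D"
    and a: "a \<in> C - D" and b: "b \<in> D - C" and nonadjacent: "{a, b} \<notin> E"
  obtains J where "min_vertex_cover V E J" "J \<subseteq> C \<union> D - {a, b}"
proof -
  have "is_vertex_cover V E (C \<union> D - {a, b})"
  proof (rule vertex_coverI)
    show "C \<union> D - {a, b} \<subseteq> V" using min_vertex_coverD(2)[OF C] min_vertex_coverD(2)[OF D] by blast
    fix x y assume xy: "{x, y} \<in> E" "x \<notin> C \<union> D - {a, b}"
    have yx: "{y, x} \<in> E" and "{b, a} \<notin> E"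
      using xy(1) nonadjacent by (simp_all add: insert_commute)
    then show "y \<in> C \<union> D - {a, b}"
      using min_vertex_coverD(3)[OF C xy(1)] min_vertex_coverD(3)[OF D xy(1)]
        min_vertex_coverD(3)[OF C yx] min_vertex_coverD(3)[OF D yx] edge_neq[OF xy(1)]
        xy a b nonadjacent
      by blast
  qed
  then show thesis using min_vertex_cover_below that by metis
qed

lemma not_min_vertex_cover_exchange:
  assumes triangle_free: "no_3_cycle E"
    and C: "min_vertex_cover V E C" and D: "min_vertex_cover V E D"
    and complete: "complete_between E (C - D) (D - C)" and big: "card (D - C) > 1"
    and t: "t \<in> D - C" and s: "s \<in> C"
  shows "\<not> min_vertex_cover V E (insert t C - {s})"
proof
  assume J: "min_vertex_cover V E (insert t C - {s})"
  show False
  proof (cases "s \<in> D")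
    case False
    have "D - C \<noteq> {t}" using big by auto
    then obtain b where b: "b \<in> D - C" "b \<noteq> t" using t by blast
    then have "{s, b} \<in> E" using complete s False unfolding complete_between_def by blast
    then show False using min_vertex_coverD(3)[OF J, of s b] b by blast
  next
    case True
    obtain b where b: "{s, b} \<in> E" "b \<notin> D" using min_vertex_cover_neighbour[OF D True] by blast
    have "b \<in> C - D" using min_vertex_coverD(3)[OF J b(1)] b t by blast
    then have bt: "{b, t} \<in> E" using complete t unfolding complete_between_def by blast
    obtain c where c: "{s, c} \<in> E" "c \<notin> C" using min_vertex_cover_neighbour[OF C s] by blast
    have "c = t" using min_vertex_coverD(3)[OF J c(1)] c(2) by blast
    then have ts: "{t, s} \<in> E" using c(1) by (simp add: insert_commute)
    have "distinct [s, b, t] \<and> adj E s b \<and> adj E b t \<and> adj E t s"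
      using b(1) bt ts edge_neq by (auto simp: adj_def)
    then show False using triangle_free unfolding no_3_cycle_def by blast
  qed
qed

end

locale unmixed_graph = finite_graph V E for V :: "'v set" and E :: "'v set set" +
  assumes unmixed: "unmixed V E"
begin

lemma card_min_vertex_covers_eq:
  "min_vertex_cover V E C \<Longrightarrow> min_vertex_cover V E D \<Longrightarrow> card C = card D"
  using unmixed unfolding unmixed_def by blast

lemma min_vertex_cover_if_card_eq:
  assumes C: "min_vertex_cover V E C" and D: "is_vertex_cover V E D" and "card D = card C"
  shows "min_vertex_cover V E D"
proof -
  obtain D' where D': "D' \<subseteq> D" "min_vertex_cover V E D'"
    using min_vertex_cover_below[OF D] by blast
  have "finite D" using D finite_vertices by (auto simp: is_vertex_cover_def intro: finite_subset)
  then have "D' = D"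
    using D' card_min_vertex_covers_eq[OF C D'(2)] assms(3) by (intro card_subset_eq) auto
  then show ?thesis using D'(2) by simp
qed

lemma card_Diff_min_vertex_covers:
  assumes C: "min_vertex_cover V E C" and D: "min_vertex_cover V E D"
  shows "card (C - D) = card (D - C)"
  using card_Diff_subset_Int[of C D] card_Diff_subset_Int[of D C] card_min_vertex_covers_eq[OF C D]
    finite_min_vertex_cover[OF C] finite_min_vertex_cover[OF D] by (simp add: Int_commute)

lemma min_vertex_cover_pair_induct [consumes 3, case_names equal exchange split]:
  assumes thin: "thin_complete_pairs V E"
    and "min_vertex_cover V E C" "min_vertex_cover V E D"
    and equal: "\<And>C. min_vertex_cover V E C \<Longrightarrow> P C C"
    and exchange: "\<And>C D a b. min_vertex_cover V E C \<Longrightarrow> min_vertex_cover V E D \<Longrightarrow>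
      C - D = {a} \<Longrightarrow> D - C = {b} \<Longrightarrow> P C D"
    and split: "\<And>C D J. min_vertex_cover V E C \<Longrightarrow> min_vertex_cover V E D \<Longrightarrow>
      min_vertex_cover V E J \<Longrightarrow> J \<subseteq> C \<union> D \<Longrightarrow> P C J \<Longrightarrow> P J D \<Longrightarrow> P C D"
  shows "P C D"
  using assms(2,3)
proof (induction "card (C - D)" arbitrary: C D rule: less_induct)
  case less
  note C = less.prems(1) and D = less.prems(2)
  have fin: "finite (C - D)" "finite (D - C)"
    using finite_min_vertex_cover C D by auto
  have card_eq: "card (C - D) = card (D - C)" by (rule card_Diff_min_vertex_covers[OF C D])
  consider (zero) "card (C - D) = 0" | (one) "card (C - D) = 1" | (many) "card (C - D) > 1"
    by linarith
  then show ?case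
  proof cases
    case zero
    then have "C - D = {}" "D - C = {}"
      using card_eq fin by (metis card_0_eq)+
    then have "C = D" by blast
    then show ?thesis using equal[OF C] by simp
  next
    case one
    then show ?thesis using card_eq exchange[OF C D] by (metis card_1_singletonE)
  next
    case many
    obtain a b where ab: "a \<in> C - D" "b \<in> D - C" "{a, b} \<notin> E"
      using thin_complete_pairs_nonadjacent[OF thin C D many] .
    obtain J where J: "min_vertex_cover V E J" "J \<subseteq> C \<union> D - {a, b}"
      using min_vertex_cover_avoiding[OF C D ab] .
    have "card (J - D) < card (C - D)" "card (J - C) < card (D - C)"
      using J(2) ab fin by (auto intro!: psubset_card_mono)
    then have "P J D" "P C J"
      using less.hyps[OF _ J(1) D] less.hyps[OF _ C J(1)] card_eq
        card_Diff_min_vertex_covers[OF C J(1)] by simp_all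
    then show ?thesis using split[OF C D J(1)] J(2) by blast
  qed
qed

end

section \<open>Matchings in unmixed bipartite graphs\<close>

definition antisym_matching :: "'v set set \<Rightarrow> 'v set \<Rightarrow> 'v set \<Rightarrow> ('v \<Rightarrow> 'v) \<Rightarrow> bool" where
  "antisym_matching E X Y \<mu> \<longleftrightarrow> bij_betw \<mu> X Y \<and> (\<forall>a\<in>X. {a, \<mu> a} \<in> E) \<and>
     (\<forall>a\<in>X. \<forall>a'\<in>X. {a, \<mu> a'} \<in> E \<and> {a', \<mu> a} \<in> E \<longrightarrow> a = a')"

lemma antisym_matching_Un:
  assumes \<mu>: "antisym_matching E X Y \<mu>" and \<nu>: "antisym_matching E X' Y' \<nu>"
    and disjoint: "X \<inter> X' = {}" "Y \<inter> Y' = {}"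
    and no_edges: "\<And>x y. x \<in> X \<Longrightarrow> y \<in> Y' \<Longrightarrow> {x, y} \<notin> E"
  shows "antisym_matching E (X \<union> X') (Y \<union> Y') (\<lambda>x. if x \<in> X then \<mu> x else \<nu> x)"
    (is "antisym_matching E _ _ ?\<rho>")
proof -
  have on_X': "?\<rho> x = \<nu> x" if "x \<in> X'" for x using that disjoint(1) by auto
  have "bij_betw ?\<rho> X Y" "bij_betw ?\<rho> X' Y'"
    using \<mu> \<nu> on_X' by (simp_all add: antisym_matching_def cong: bij_betw_cong)
  then have bij: "bij_betw ?\<rho> (X \<union> X') (Y \<union> Y')"
    using disjoint(2) by (rule bij_betw_combine)
  have cross: "{x, ?\<rho> y} \<notin> E" if "x \<in> X" "y \<in> X'" for x y
    using no_edges[OF that(1), of "\<nu> y"] \<nu> that(2) on_X'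
    by (auto simp: antisym_matching_def bij_betw_def)
  have "a = a'" if "a \<in> X \<union> X'" "a' \<in> X \<union> X'" "{a, ?\<rho> a'} \<in> E" "{a', ?\<rho> a} \<in> E" for a a'
    using that cross[of a a'] cross[of a' a] \<mu> \<nu> unfolding antisym_matching_def
    by (auto split: if_splits)
  then show ?thesis
    using bij \<mu> \<nu> on_X' by (auto simp: antisym_matching_def)
qed

locale bipartite_graph = finite_graph "A \<union> B" E for A B :: "'v set" and E :: "'v set set" +
  assumes disjoint: "A \<inter> B = {}"
    and edges: "\<And>x y. {x, y} \<in> E \<Longrightarrow> x \<in> A \<and> y \<in> B \<or> x \<in> B \<and> y \<in> A"
begin

lemma Int_subset_min_vertex_cover:
  assumes C: "min_vertex_cover (A \<union> B) E C" and D: "min_vertex_cover (A \<union> B) E D"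
    and J: "min_vertex_cover (A \<union> B) E J" "J \<subseteq> C \<union> D"
    and nested: "D \<inter> A \<subseteq> C" "C \<inter> B \<subseteq> D"
  shows "C \<inter> D \<subseteq> J"
proof
  fix z assume z: "z \<in> C \<inter> D"
  show "z \<in> J"
  proof (rule ccontr)
    assume "z \<notin> J"
    then have neighbour: "y \<in> C \<union> D" if "{z, y} \<in> E" for y
      using min_vertex_coverD(3)[OF J(1) that] J(2) by blast
    obtain y where y: "{z, y} \<in> E" "y \<notin> D" using min_vertex_cover_neighbour[OF D, of z] z by blast
    obtain y' where y': "{z, y'} \<in> E" "y' \<notin> C" using min_vertex_cover_neighbour[OF C, of z] z by blast
    show False
      using neighbour[OF y(1)] neighbour[OF y'(1)] edges[OF y(1)] edges[OF y'(1)] y(2) y'(2)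
        nested disjoint by blast
  qed
qed

end

locale unmixed_bipartite_graph = bipartite_graph A B E + unmixed_graph "A \<union> B" E
  for A B :: "'v set" and E :: "'v set set"
begin

lemma antisym_matching_exists:
  assumes thin: "thin_complete_pairs (A \<union> B) E"
    and C: "min_vertex_cover (A \<union> B) E C" and D: "min_vertex_cover (A \<union> B) E D"
    and nested: "D \<inter> A \<subseteq> C" "C \<inter> B \<subseteq> D"
  shows "\<exists>\<mu>. antisym_matching E (C - D) (D - C) \<mu>"
  using thin C D nested
proof (induction C D rule: min_vertex_cover_pair_induct)
  case (equal C)
  show ?case by (auto simp: antisym_matching_def bij_betw_def)
next
  case (exchange C D a b)
  obtain y where y: "{a, y} \<in> E" "y \<notin> C"
    using min_vertex_cover_neighbour[OF exchange(1), of a] exchange(3) by blast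
  then have "y = b"
    using min_vertex_coverD(3)[OF exchange(2) y(1)] exchange(3,4) by blast
  then show ?case
    using y(1) exchange(3,4)
    by (intro exI[of _ "\<lambda>_. b"]) (auto simp: antisym_matching_def bij_betw_def)
next
  case (split C D J)
  have "C \<inter> D \<subseteq> J"
    by (rule Int_subset_min_vertex_cover[OF split(1-4) split.prems])
  then have nested: "J \<inter> A \<subseteq> C" "C \<inter> B \<subseteq> J" "D \<inter> A \<subseteq> J" "J \<inter> B \<subseteq> D"
    and pieces: "C - D = (C - J) \<union> (J - D)" "D - C = (J - C) \<union> (D - J)"
    using split(4) split.prems by blast+
  obtain \<mu> \<nu> where "antisym_matching E (C - J) (J - C) \<mu>" "antisym_matching E (J - D) (D - J) \<nu>"
    using split.IH nested by blast
  moreover have "{x, y} \<notin> E" if "x \<in> C - J" "y \<in> D - J" for x y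
    using min_vertex_coverD(3)[OF split(3), of x y] that by blast
  ultimately have "antisym_matching E ((C - J) \<union> (J - D)) ((J - C) \<union> (D - J))
      (\<lambda>x. if x \<in> C - J then \<mu> x else \<nu> x)"
    by (intro antisym_matching_Un) blast+
  then show ?case unfolding pieces by blast
qed

lemma antisym_matching_trans:
  assumes A: "min_vertex_cover (A \<union> B) E A" and \<mu>: "antisym_matching E A B \<mu>"
    and in_A: "a \<in> A" "a' \<in> A" "a'' \<in> A" and adjacent: "{a, \<mu> a'} \<in> E" "{a', \<mu> a''} \<in> E"
  shows "{a, \<mu> a''} \<in> E"
proof (rule ccontr)
  assume nonadjacent: "{a, \<mu> a''} \<notin> E"
  have bij: "bij_betw \<mu> A B" and matched: "\<And>x. x \<in> A \<Longrightarrow> {x, \<mu> x} \<in> E"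
    using \<mu> by (simp_all add: antisym_matching_def)
  have fin: "finite A" "finite B" using finite_vertices by simp_all
  have "is_vertex_cover (A \<union> B) E (A \<union> B - {a, \<mu> a''})"
  proof (rule vertex_coverI)
    fix x y assume "{x, y} \<in> E" "x \<notin> A \<union> B - {a, \<mu> a''}"
    then show "y \<in> A \<union> B - {a, \<mu> a''}"
      using edge_neq[of x y] edge_in[of x y] nonadjacent by (auto simp: insert_commute)
  qed blast
  then obtain D where D: "D \<subseteq> A \<union> B - {a, \<mu> a''}" "min_vertex_cover (A \<union> B) E D"
    by (rule min_vertex_cover_below)
  have a'D: "a' \<in> D" "\<mu> a' \<in> D"
    using min_vertex_coverD(3)[OF D(2), of "\<mu> a''" a'] min_vertex_coverD(3)[OF D(2) adjacent(1)]
      D(1) adjacent(2) by (auto simp: insert_commute)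
  have "\<mu> ` insert a' (A - D) \<subseteq> D \<inter> B"
    using min_vertex_coverD(3)[OF D(2) matched] a'D bij in_A by (auto simp: bij_betw_def)
  then have "card (\<mu> ` insert a' (A - D)) \<le> card (D \<inter> B)"
    using fin by (intro card_mono) auto
  moreover have "card (\<mu> ` insert a' (A - D)) = card (insert a' (A - D))"
    by (rule card_image, rule inj_on_subset[OF bij_betw_imp_inj_on[OF bij]]) (use in_A in auto)
  ultimately have "Suc (card (A - D)) \<le> card (D \<inter> B)" using a'D fin by simp
  moreover have "card A = card (A \<inter> D) + card (A - D)"
    using card_Int_Diff fin by metis
  moreover have "D = (A \<inter> D) \<union> (D \<inter> B)" using D(1) by blast
  then have "card D = card (A \<inter> D) + card (D \<inter> B)"
    using card_Un_disjoint[of "A \<inter> D" "D \<inter> B"] disjoint fin by auto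
  moreover have "card D = card A" by (rule card_min_vertex_covers_eq[OF D(2) A])
  ultimately show False by linarith
qed

end

section \<open>Renaming variables\<close>

definition pushforward :: "('a \<Rightarrow> 'b) \<Rightarrow> ('a \<Rightarrow>\<^sub>0 'c::comm_monoid_add) \<Rightarrow> ('b \<Rightarrow>\<^sub>0 'c)" where
  "pushforward f p = (\<Sum>k\<in>keys p. single (f k) (lookup p k))"

lemma pushforward_superset:
  assumes "finite A" "keys p \<subseteq> A"
  shows "pushforward f p = (\<Sum>k\<in>A. single (f k) (lookup p k))"
  unfolding pushforward_def using assms by (intro sum.mono_neutral_left) (auto simp: in_keys_iff)

lemma pushforward_single [simp]: "pushforward f (single k c) = single (f k) c"
  by (simp add: pushforward_def)

lemma pushforward_0 [simp]: "pushforward f 0 = 0"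
  by (simp add: pushforward_def)

lemma pushforward_add: "pushforward f (p + q) = pushforward f p + pushforward f q"
  using keys_add[of p q]
  by (simp add: pushforward_superset[of "keys p \<union> keys q"] lookup_add single_add sum.distrib)

lemma pushforward_diff:
  "pushforward f (p - q :: 'a \<Rightarrow>\<^sub>0 'c::ab_group_add) = pushforward f p - pushforward f q"
  using pushforward_add[of f "p - q" q] by simp

lemma pushforward_mult:
  fixes p q :: "'a::comm_monoid_add \<Rightarrow>\<^sub>0 'c::semiring_0" and f :: "'a \<Rightarrow> 'b::comm_monoid_add"
  assumes "\<And>k l. f (k + l) = f k + f l"
  shows "pushforward f (p * q) = pushforward f p * pushforward f q"
proof (induction p rule: poly_mapping_additive_induct)
  case (single k c)
  show ?case
    by (induction q rule: poly_mapping_additive_induct)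
       (simp_all add: mult_single assms distrib_left pushforward_add)
qed (simp add: distrib_right pushforward_add)

lemma pushforward_id: "pushforward (\<lambda>k. k) = (\<lambda>p. p)"
  by (simp add: pushforward_def poly_mapping_sum_single fun_eq_iff)

definition rename_vars :: "('v \<Rightarrow> 'w) \<Rightarrow> ('v, 'k::field) mpoly \<Rightarrow> ('w, 'k) mpoly" where
  "rename_vars \<rho> = pushforward (pushforward \<rho>)"

lemma rename_vars_const [simp]: "rename_vars \<rho> (single 0 c) = single 0 c"
  by (simp add: rename_vars_def)

lemma rename_vars_1 [simp]: "rename_vars \<rho> 1 = 1"
  using rename_vars_const[of \<rho> 1] by simp

lemma rename_vars_var [simp]: "rename_vars \<rho> (var v) = var (\<rho> v)"
  by (simp add: rename_vars_def var_def)

lemma rename_vars_0 [simp]: "rename_vars \<rho> 0 = 0"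
  by (simp add: rename_vars_def)

lemma rename_vars_add [simp]: "rename_vars \<rho> (p + q) = rename_vars \<rho> p + rename_vars \<rho> q"
  by (simp add: rename_vars_def pushforward_add)

lemma rename_vars_diff [simp]: "rename_vars \<rho> (p - q) = rename_vars \<rho> p - rename_vars \<rho> q"
  by (simp add: rename_vars_def pushforward_diff)

lemma rename_vars_mult [simp]: "rename_vars \<rho> (p * q) = rename_vars \<rho> p * rename_vars \<rho> q"
  unfolding rename_vars_def by (rule pushforward_mult) (rule pushforward_add)

lemma rename_vars_id: "rename_vars (\<lambda>v. v) p = p"
  by (simp add: rename_vars_def pushforward_id)

lemma rename_vars_polys:
  assumes \<rho>: "\<rho> ` V \<subseteq> W" and p: "p \<in> polys K V"
  shows "rename_vars \<rho> p \<in> polys K W"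
  using p by (induction rule: polys_induct) (use \<rho> in auto)

lemma diff_rename_vars_in_ideal:
  assumes J: "is_ideal K V J" and \<rho>: "\<rho> ` V \<subseteq> V"
    and identified: "\<And>v. v \<in> V \<Longrightarrow> var v - var (\<rho> v) \<in> J" and p: "p \<in> polys K V"
  shows "p - rename_vars \<rho> p \<in> J"
  using p
proof (induction rule: polys_induct)
  case (const c)
  show ?case using is_idealD(2)[OF J] by simp
next
  case (var v)
  then show ?case using identified by simp
next
  case (add p q)
  have "(p - rename_vars \<rho> p) + (q - rename_vars \<rho> q) \<in> J"
    using add by (intro is_idealD(3)[OF J])
  then show ?case by (simp add: algebra_simps)
next
  case (mult p q)
  have "p * (q - rename_vars \<rho> q) + rename_vars \<rho> q * (p - rename_vars \<rho> p) \<in> J"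
    using mult rename_vars_polys[OF \<rho>] by (intro is_idealD(3)[OF J] is_idealD(4)[OF J])
  then show ?case by (simp add: algebra_simps)
qed

section \<open>Edge ideals\<close>

definition edge_multiple :: "('v \<Rightarrow> 'v) \<Rightarrow> 'v set set \<Rightarrow> ('v \<Rightarrow>\<^sub>0 nat) \<Rightarrow> bool" where
  "edge_multiple \<rho> E w \<longleftrightarrow> (\<exists>x y. {x, y} \<in> E \<and> single (\<rho> x) 1 + single (\<rho> y) 1 adds w)"

lemma edge_multipleI: "{x, y} \<in> E \<Longrightarrow> single (\<rho> x) 1 + single (\<rho> y) 1 adds w \<Longrightarrow> edge_multiple \<rho> E w"
  unfolding edge_multiple_def by blast

lemma upward_closed_edge_multiple: "upward_closed (edge_multiple \<rho> E)"
  unfolding upward_closed_def edge_multiple_def using adds_plus_left by blast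

context finite_graph
begin

lemma edge_generators_subset_polys: "{var a * var b | a b. {a, b} \<in> E} \<subseteq> polys K V"
  using edge_in by (force intro: polys_mult)

lemma is_ideal_edge_ideal: "is_ideal K V (edge_ideal K V E)"
  unfolding edge_ideal_def by (intro is_ideal_gen_ideal edge_generators_subset_polys)

lemma edge_in_edge_ideal: "{a, b} \<in> E \<Longrightarrow> var a * var b \<in> edge_ideal K V E"
  unfolding edge_ideal_def by (rule gen_ideal_base) blast

lemma edge_ideal_least:
  assumes "is_ideal K V J" "\<And>a b. {a, b} \<in> E \<Longrightarrow> var a * var b \<in> J"
  shows "edge_ideal K V E \<subseteq> J"
  unfolding edge_ideal_def using assms by (intro gen_ideal_least) auto

lemma rename_vars_edge_in_monomial_ideal:
  fixes K :: "'k::field itself"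
  assumes edge: "{a, b} \<in> E" and \<rho>: "\<rho> ` V \<subseteq> V"
  shows "rename_vars \<rho> (var a * var b) \<in> monomial_ideal K V (edge_multiple \<rho> E)"
proof (rule monomial_idealI)
  show "rename_vars \<rho> (var a * var b) \<in> polys K V"
    using edge_in[OF edge] by (intro rename_vars_polys[OF \<rho>] polys_mult) auto
  fix k assume "k \<in> keys (rename_vars \<rho> (var a * var b :: ('v, 'k) mpoly))"
  then have "k \<in> keys (var (\<rho> a) * var (\<rho> b) :: ('v, 'k) mpoly)"
    by simp
  then have "k = single (\<rho> a) 1 + single (\<rho> b) 1"
    by (simp add: var_def mult_single)
  then show "edge_multiple \<rho> E k"
    using edge_multipleI[OF edge adds_refl] by simp
qed

lemma monomial_ideal_edge_multiple_subset:
  assumes J: "is_ideal K V J" "edge_ideal K V E \<subseteq> J" and \<rho>: "\<rho> ` V \<subseteq> V"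
    and identified: "\<And>v. v \<in> V \<Longrightarrow> var v - var (\<rho> v) \<in> J"
  shows "monomial_ideal K V (edge_multiple \<rho> E) \<subseteq> J"
proof (rule monomial_ideal_subset[OF J(1)])
  fix w assume "edge_multiple \<rho> E w" and w: "keys w \<subseteq> V"
  then obtain x y l where xy: "{x, y} \<in> E" and l: "w = single (\<rho> x) 1 + single (\<rho> y) 1 + l"
    unfolding edge_multiple_def by (metis addsE)
  have "var x * var y \<in> J"
    using edge_in_edge_ideal[OF xy] J(2) by blast
  moreover have "var x * var y - rename_vars \<rho> (var x * var y) \<in> J"
    using edge_in[OF xy] by (intro diff_rename_vars_in_ideal[OF J(1) \<rho> identified]) auto
  ultimately have renamed: "var (\<rho> x) * var (\<rho> y) \<in> J"
    using is_ideal_diff[OF J(1)] by fastforce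
  have "single l 1 \<in> polys K V"
    using w by (intro polys_single) (simp add: l keys_plus_nat)
  then have "single l 1 * (var (\<rho> x) * var (\<rho> y)) \<in> J"
    by (rule is_idealD(4)[OF J(1) _ renamed])
  then show "single w 1 \<in> J"
    by (simp add: l var_def mult_single add.commute)
qed

text \<open>Modulo the linear forms in \<open>D\<close>, which identify \<open>v\<close> with \<open>\<rho> v\<close>, the edge ideal becomes a monomial
  ideal. It need not be squarefree, since the ends of an edge may be identified.\<close>

lemma gen_ideal_edge_ideal_Un:
  fixes K :: "'k::field itself"
  assumes \<rho>: "\<rho> ` V \<subseteq> V" and D: "D \<subseteq> polys K V" "\<And>d. d \<in> D \<Longrightarrow> rename_vars \<rho> d = 0"
    and identified: "\<And>v. v \<in> V \<Longrightarrow> var v - var (\<rho> v) \<in> gen_ideal K V D"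
  shows "gen_ideal K V (edge_ideal K V E \<union> D) =
    {p \<in> polys K V. rename_vars \<rho> p \<in> monomial_ideal K V (edge_multiple \<rho> E)}"
    (is "?J = ?L")
proof
  have M: "is_ideal K V (monomial_ideal K V (edge_multiple \<rho> E))"
    by (rule is_ideal_monomial_ideal[OF upward_closed_edge_multiple])
  have L: "is_ideal K V ?L"
    using is_idealD(2,3)[OF M] is_idealD(4)[OF M rename_vars_polys[OF \<rho>]]
    by (auto simp: is_ideal_def)
  have "edge_ideal K V E \<subseteq> ?L"
    using rename_vars_edge_in_monomial_ideal[OF _ \<rho>] edge_in
    by (intro edge_ideal_least[OF L]) (auto simp del: rename_vars_mult)
  moreover have "D \<subseteq> ?L" using D is_idealD(2)[OF M] by auto
  ultimately show "?J \<subseteq> ?L" by (intro gen_ideal_least[OF L]) simp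
  have union: "edge_ideal K V E \<union> D \<subseteq> polys K V"
    using is_idealD(1)[OF is_ideal_edge_ideal] D(1) by auto
  then have J: "is_ideal K V ?J" by (rule is_ideal_gen_ideal)
  have identified_J: "var v - var (\<rho> v) \<in> ?J" if "v \<in> V" for v
    using gen_ideal_mono[OF Un_upper2 union] identified[OF that] by blast
  show "?L \<subseteq> ?J"
  proof
    fix p assume "p \<in> ?L"
    then have p: "p \<in> polys K V" "rename_vars \<rho> p \<in> monomial_ideal K V (edge_multiple \<rho> E)" by auto
    have "edge_ideal K V E \<subseteq> ?J"
      using gen_ideal_superset[of "edge_ideal K V E \<union> D"] by blast
    then have "rename_vars \<rho> p \<in> ?J"
      using monomial_ideal_edge_multiple_subset[OF J _ \<rho> identified_J] p(2) by blast
    moreover have "p - rename_vars \<rho> p \<in> ?J"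
      by (rule diff_rename_vars_in_ideal[OF J \<rho> identified_J p(1)])
    ultimately show "p \<in> ?J" using is_idealD(3)[OF J] by fastforce
  qed
qed

lemma edge_ideal_eq:
  "edge_ideal K V E = monomial_ideal K V (\<lambda>k. \<exists>x y. {x, y} \<in> E \<and> x \<in> keys k \<and> y \<in> keys k)"
proof -
  have "edge_multiple (\<lambda>v. v) E k \<longleftrightarrow> (\<exists>x y. {x, y} \<in> E \<and> x \<in> keys k \<and> y \<in> keys k)" for k
    unfolding edge_multiple_def using edge_neq two_vars_adds_iff by metis
  moreover have "edge_ideal K V E = gen_ideal K V (edge_ideal K V E \<union> {})"
    by (simp add: gen_ideal_of_ideal[OF is_ideal_edge_ideal])
  moreover have "\<dots> = monomial_ideal K V (edge_multiple (\<lambda>v. v) E)"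
    using is_idealD(2)[OF is_ideal_gen_ideal[of "{}" K V]]
    by (subst gen_ideal_edge_ideal_Un[of "\<lambda>v. v"])
      (auto simp: rename_vars_id monomial_ideal_polys)
  ultimately show ?thesis by presburger
qed

lemma krull_dim_edge_ideal_le:
  assumes n: "\<And>C. is_vertex_cover V E C \<Longrightarrow> card (V - C) \<le> n"
  shows "krull_dim_quot K V (edge_ideal K V E) \<le> enat n"
proof (rule krull_dim_quot_le)
  fix P m assume chain: "prime_chain K V (edge_ideal K V E) P m"
  then have P_0: "is_prime_ideal K V (P 0)" "edge_ideal K V E \<subseteq> P 0"
    by (auto simp: prime_chain_def)
  define C where "C = {v \<in> V. var v \<in> P 0}"
  have "is_vertex_cover V E C"
  proof (rule vertex_coverI)
    fix x y assume xy: "{x, y} \<in> E" "x \<notin> C"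
    have "var x * var y \<in> P 0" using P_0(2) edge_in_edge_ideal[OF xy(1)] by blast
    then have "var x \<in> P 0 \<or> var y \<in> P 0"
      using edge_in[OF xy(1)] by (intro is_prime_idealD(3)[OF P_0(1)]) auto
    then show "y \<in> C" using xy edge_in[OF xy(1)] by (auto simp: C_def)
  qed (simp add: C_def)
  moreover have "m \<le> card (V - C)"
    using finite_vertices
    by (intro prime_chain_length_le[OF prime_chain_above_first[OF chain]]) (auto simp: C_def)
  ultimately show "enat m \<le> enat n" using n by (metis enat_ord_simps(1) le_trans)
qed

lemma card_le_krull_dim_edge_ideal:
  assumes C: "is_vertex_cover V E C"
  shows "enat (card (V - C)) \<le> krull_dim_quot K V (edge_ideal K V E)"
proof -
  have C_subset: "C \<subseteq> V" using C by (simp add: is_vertex_cover_def)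
  obtain bs where bs: "distinct bs" "set bs = V - C"
    using finite_distinct_list[of "V - C"] finite_vertices by auto
  have "regular_seq K V (var ` C) (map var bs)"
    using C_subset bs by (intro regular_seq_vars) auto
  then have "enat (length bs) \<le> krull_dim_quot K V (var ` C)"
    using C_subset
    by (metis length_map length_regular_seq_le_krull_dim_quot image_subsetI polys_var subsetD)
  also have "\<dots> \<le> krull_dim_quot K V (edge_ideal K V E)"
  proof (rule krull_dim_quot_antimono, rule edge_ideal_least)
    show ideal: "is_ideal K V (vars_ideal K V C)"
      using C_subset by (intro is_ideal_gen_ideal) auto
    fix a b assume ab: "{a, b} \<in> E"
    have generators: "var c \<in> vars_ideal K V C" if "c \<in> C" for c
      using that by (intro gen_ideal_base) blast
    have "a \<in> C \<or> b \<in> C" using vertex_coverD[OF C ab] by blast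
    then show "var a * var b \<in> vars_ideal K V C"
      using is_idealD(4)[OF ideal _ generators, of "var a" b]
        is_ideal_mult_right[OF ideal _ generators, of "var b" a] edge_in[OF ab] by auto
  qed
  finally show ?thesis
    using distinct_card[OF bs(1)] bs(2) by simp
qed

end

section \<open>Cohen--Macaulay bipartite graphs\<close>

text \<open>The partial order on \<open>A\<close> is given by \<open>a \<le> a'\<close> iff \<open>a\<close> is adjacent to \<open>\<mu> a'\<close>.\<close>

locale poset_bipartite_graph = bipartite_graph A B E for A B :: "'v set" and E :: "'v set set" +
  fixes \<mu> :: "'v \<Rightarrow> 'v"
  assumes bij: "bij_betw \<mu> A B"
    and adj_refl: "\<And>a. a \<in> A \<Longrightarrow> {a, \<mu> a} \<in> E"
    and adj_trans: "\<And>a b c. a \<in> A \<Longrightarrow> b \<in> A \<Longrightarrow> c \<in> A \<Longrightarrow> {a, \<mu> b} \<in> E \<Longrightarrow> {b, \<mu> c} \<in> E \<Longrightarrow> {a, \<mu> c} \<in> E"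
    and adj_antisym: "\<And>a b. a \<in> A \<Longrightarrow> b \<in> A \<Longrightarrow> {a, \<mu> b} \<in> E \<Longrightarrow> {b, \<mu> a} \<in> E \<Longrightarrow> a = b"
begin

definition ident :: "'v set \<Rightarrow> 'v \<Rightarrow> 'v" where
  "ident F v = (if v \<in> \<mu> ` F then inv_into A \<mu> v else v)"

definition ident_ideal :: "'k::field itself \<Rightarrow> 'v set \<Rightarrow> ('v, 'k) mpoly set" where
  "ident_ideal K F = gen_ideal K (A \<union> B) (edge_ideal K (A \<union> B) E \<union> (\<lambda>a. var a - var (\<mu> a)) ` F)"

lemma mu_in: "a \<in> A \<Longrightarrow> \<mu> a \<in> B"
  using bij by (auto simp: bij_betw_def)

lemma mu_notin: "a \<in> A \<Longrightarrow> \<mu> a \<notin> A"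
  using mu_in disjoint by blast

lemma mu_inj: "a \<in> A \<Longrightarrow> a' \<in> A \<Longrightarrow> \<mu> a = \<mu> a' \<longleftrightarrow> a = a'"
  using bij by (auto simp: bij_betw_def inj_on_def)

lemma ident_mu: "F \<subseteq> A \<Longrightarrow> a \<in> A \<Longrightarrow> ident F (\<mu> a) = (if a \<in> F then a else \<mu> a)"
  using bij mu_inj by (auto simp: ident_def bij_betw_def)

lemma ident_A: "F \<subseteq> A \<Longrightarrow> a \<in> A \<Longrightarrow> ident F a = a"
  using mu_notin by (auto simp: ident_def)

lemma ident_image: "F \<subseteq> A \<Longrightarrow> ident F ` (A \<union> B) \<subseteq> A \<union> B"
  using bij ident_mu[of F] by (auto simp: ident_A bij_betw_def)

lemma edgeE:
  assumes "{x, y} \<in> E"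
  obtains a a' where "a \<in> A" "a' \<in> A" "{a, \<mu> a'} \<in> E" "{x, y} = {a, \<mu> a'}"
proof -
  obtain a b where ab: "{x, y} = {a, b}" "a \<in> A" "b \<in> B"
    using edges[OF assms] by (auto simp: insert_commute)
  moreover obtain a' where "a' \<in> A" "b = \<mu> a'"
    using bij ab(3) by (auto simp: bij_betw_def)
  ultimately show thesis using that assms by simp
qed

lemma edge_multiple_identE:
  assumes F: "F \<subseteq> A" and w: "edge_multiple (ident F) E w"
  obtains a a' where "a \<in> A" "a' \<in> A" "{a, \<mu> a'} \<in> E" "single a 1 + single (ident F (\<mu> a')) 1 adds w"
proof -
  obtain x y where xy: "{x, y} \<in> E" "single (ident F x) 1 + single (ident F y) 1 adds w"
    using w unfolding edge_multiple_def by blast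
  obtain a a' where a: "a \<in> A" "a' \<in> A" "{a, \<mu> a'} \<in> E" "{x, y} = {a, \<mu> a'}"
    by (rule edgeE[OF xy(1)])
  then have "single a 1 + single (ident F (\<mu> a')) 1 adds w"
    using xy(2) ident_A[OF F a(1)] by (auto simp: doubleton_eq_iff add.commute)
  then show thesis using that a by blast
qed

lemma edge_multiple_if_both:
  assumes F: "F \<subseteq> A" and a: "a \<in> A" "a \<notin> F" and w: "a \<in> keys w" "\<mu> a \<in> keys w"
  shows "edge_multiple (ident F) E w"
proof (rule edge_multipleI[OF adj_refl[OF a(1)]])
  have "a \<noteq> \<mu> a" using a(1) mu_notin[OF a(1)] by auto
  then have "single a 1 + single (\<mu> a) 1 adds w"
    using w by (intro two_vars_adds_iff[THEN iffD2]) auto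
  then show "single (ident F a) 1 + single (ident F (\<mu> a)) 1 adds w"
    using a by (simp add: ident_A[OF F] ident_mu[OF F])
qed

lemma new_edge_multiple_at_A:
  assumes F: "F \<subseteq> A" and a: "a \<in> A" "a \<notin> F"
    and w: "edge_multiple (ident F) E (single a 1 + w)" "\<not> edge_multiple (ident F) E w"
  obtains c where "c \<in> A" "{a, \<mu> c} \<in> E" "ident F (\<mu> c) \<in> keys w"
proof -
  obtain b c where bc: "b \<in> A" "c \<in> A" "{b, \<mu> c} \<in> E"
    and adds: "single b 1 + single (ident F (\<mu> c)) 1 adds single a 1 + w"
    using w(1) by (rule edge_multiple_identE[OF F])
  have "\<not> single b 1 + single (ident F (\<mu> c)) 1 adds w"
    using edge_multipleI[OF bc(3), of "ident F" w] w(2) ident_A[OF F bc(1)] by auto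
  moreover have "ident F (\<mu> c) \<noteq> a"
    using ident_mu[OF F bc(2)] a mu_notin[OF bc(2)] by (auto split: if_splits)
  ultimately have "b = a"
    using adds_single_plus_cancel[OF adds] by (auto simp: keys_plus_nat)
  then have "ident F (\<mu> c) \<in> keys w"
    using adds by (simp only: adds_add_cancel_left single_1_adds_iff)
  then show thesis using that bc \<open>b = a\<close> by blast
qed

lemma new_edge_multiple_at_mu:
  assumes F: "F \<subseteq> A" and a: "a \<in> A"
    and w: "edge_multiple (ident F) E (single (\<mu> a) 1 + w)" "\<not> edge_multiple (ident F) E w"
  obtains d where "d \<in> A" "{d, \<mu> a} \<in> E" "d \<in> keys w"
proof -
  obtain d e where de: "d \<in> A" "e \<in> A" "{d, \<mu> e} \<in> E"
    and adds: "single d 1 + single (ident F (\<mu> e)) 1 adds single (\<mu> a) 1 + w"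
    using w(1) by (rule edge_multiple_identE[OF F])
  have "\<not> single d 1 + single (ident F (\<mu> e)) 1 adds w"
    using edge_multipleI[OF de(3), of "ident F" w] w(2) ident_A[OF F de(1)] by auto
  moreover have "d \<noteq> \<mu> a" using de(1) mu_notin[OF a] by blast
  ultimately have ident_e: "ident F (\<mu> e) = \<mu> a"
    using adds_single_plus_cancel[OF adds] by (fastforce simp: keys_plus_nat)
  then have "d \<in> keys w"
    using adds by (simp only: add.commute[of "single d 1"] adds_add_cancel_left single_1_adds_iff)
  moreover have "e = a"
    using ident_e ident_mu[OF F de(2)] mu_inj[OF de(2) a] mu_notin[OF a] de(2)
    by (auto split: if_splits)
  ultimately show thesis using that de by blast
qed

text \<open>If both \<open>a\<close> and \<open>\<mu> a\<close> multiply \<open>w\<close> into the ideal, transitivity produces an edge inside \<open>w\<close>;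
  its ends are not identified, by antisymmetry.\<close>

lemma edge_multiple_saturated:
  assumes F: "F \<subseteq> A" and a: "a \<in> A" "a \<notin> F"
    and w: "edge_multiple (ident F) E (single a 1 + w)"
      "edge_multiple (ident F) E (single (\<mu> a) 1 + w)"
  shows "edge_multiple (ident F) E w"
proof (rule ccontr)
  assume not_multiple: "\<not> edge_multiple (ident F) E w"
  obtain c where c: "c \<in> A" "{a, \<mu> c} \<in> E" "ident F (\<mu> c) \<in> keys w"
    using new_edge_multiple_at_A[OF F a w(1) not_multiple] .
  obtain d where d: "d \<in> A" "{d, \<mu> a} \<in> E" "d \<in> keys w"
    using new_edge_multiple_at_mu[OF F a(1) w(2) not_multiple] .
  have "d \<noteq> ident F (\<mu> c)"
  proof
    assume "d = ident F (\<mu> c)"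
    then have "c \<in> F" "d = c"
      using ident_mu[OF F c(1)] d(1) mu_notin[OF c(1)] by (auto split: if_splits)
    then show False
      using adj_antisym[OF a(1) c(1,2)] d(2) a(2) by simp
  qed
  then have "single (ident F d) 1 + single (ident F (\<mu> c)) 1 adds w"
    unfolding ident_A[OF F d(1)] by (rule two_vars_adds_iff[THEN iffD2]) (simp add: c(3) d(3))
  then show False
    using edge_multipleI[OF adj_trans[OF d(1) a(1) c(1) d(2) c(2)]] not_multiple by blast
qed

lemma ident_ideal_eq:
  fixes K :: "'k::field itself"
  assumes F: "F \<subseteq> A"
  shows "ident_ideal K F = {p \<in> polys K (A \<union> B).
    rename_vars (ident F) p \<in> monomial_ideal K (A \<union> B) (edge_multiple (ident F) E)}"
  unfolding ident_ideal_def
proof (rule gen_ideal_edge_ideal_Un[OF ident_image[OF F]])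
  let ?D = "(\<lambda>a. var a - var (\<mu> a) :: ('v, 'k) mpoly) ` F"
  show D: "?D \<subseteq> polys K (A \<union> B)" using F mu_in by (auto intro!: polys_diff)
  then have ideal: "is_ideal K (A \<union> B) (gen_ideal K (A \<union> B) ?D)" by (rule is_ideal_gen_ideal)
  show "rename_vars (ident F) d = 0" if "d \<in> ?D" for d
    using that F by (auto simp: ident_A ident_mu subset_iff)
  show "var v - var (ident F v) \<in> gen_ideal K (A \<union> B) ?D" for v
  proof (cases "v \<in> \<mu> ` F")
    case True
    then obtain a where a: "a \<in> F" "v = \<mu> a" by blast
    then have "- (var a - var (\<mu> a)) \<in> gen_ideal K (A \<union> B) ?D"
      by (intro is_ideal_uminus[OF ideal] gen_ideal_base) blast
    then show ?thesis using a ident_mu[OF F, of a] F by auto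
  next
    case False
    then show ?thesis using is_idealD(2)[OF ideal] by (simp add: ident_def)
  qed
qed

lemma ident_ideal_regular_mod:
  assumes F: "F \<subseteq> A" and a: "a \<in> A" "a \<notin> F"
  shows "regular_mod K (A \<union> B) (ident_ideal K F) (var a - var (\<mu> a))"
proof -
  have "regular_mod K (A \<union> B) (monomial_ideal K (A \<union> B) (edge_multiple (ident F) E))
      (var a - var (\<mu> a))"
    using edge_multiple_if_both[OF F a] edge_multiple_saturated[OF F a]
    by (intro regular_mod_monomial_ideal_var_diff upward_closed_edge_multiple)
  then show ?thesis
    using rename_vars_polys[OF ident_image[OF F]] F a
    by (auto simp: regular_mod_def ident_ideal_eq[OF F] ident_A ident_mu)
qed

lemma regular_seq_var_diffs:
  assumes as: "distinct as" "set as = A"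
  shows "regular_seq K (A \<union> B) (edge_ideal K (A \<union> B) E) (map (\<lambda>a. var a - var (\<mu> a)) as)"
  unfolding regular_seq_iff
proof (intro conjI)
  have "weakly_regular_seq K (A \<union> B) (edge_ideal K (A \<union> B) E) (map (\<lambda>a. var a - var (\<mu> a)) bs)"
    if "distinct bs" "set bs \<subseteq> A" for bs
    using that
    by (induction bs rule: rev_induct)
      (auto simp: ident_ideal_def[symmetric] ident_ideal_regular_mod)
  then show "weakly_regular_seq K (A \<union> B) (edge_ideal K (A \<union> B) E) (map (\<lambda>a. var a - var (\<mu> a)) as)"
    using as by simp
  have "is_ideal K (A \<union> B) (max_hom_ideal K (A \<union> B))"
    unfolding max_hom_ideal_def by (rule is_ideal_gen_ideal) auto
  then show "set (map (\<lambda>a. var a - var (\<mu> a)) as) \<subseteq> max_hom_ideal K (A \<union> B)"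
    using as(2) mu_in by (auto intro!: is_ideal_diff var_in_max_hom_ideal)
  have "\<not> edge_multiple (ident A) E 0"
    by (auto elim!: edge_multiple_identE[OF subset_refl] dest!: keys_subset_if_adds
        simp: keys_plus_nat)
  then have "1 \<notin> ident_ideal K A"
    unfolding ident_ideal_eq[OF subset_refl] by (simp add: monomial_ideal_def)
  then show "1 \<notin> gen_ideal K (A \<union> B) (edge_ideal K (A \<union> B) E \<union> set (map (\<lambda>a. var a - var (\<mu> a)) as))"
    using as(2) by (simp add: ident_ideal_def)
qed

lemma card_Diff_vertex_cover_le:
  assumes C: "is_vertex_cover (A \<union> B) E C"
  shows "card (A \<union> B - C) \<le> card A"
proof -
  have fin: "finite A" "finite B" using finite_vertices by simp_all
  have "\<mu> ` (A - C) \<subseteq> B \<inter> C"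
    using vertex_coverD[OF C adj_refl] mu_in by blast
  then have "card (\<mu> ` (A - C)) \<le> card (B \<inter> C)"
    using fin by (intro card_mono) auto
  moreover have "card (\<mu> ` (A - C)) = card (A - C)"
    by (rule card_image, rule inj_on_subset[OF bij_betw_imp_inj_on[OF bij]]) blast
  moreover have "card (A \<union> B - C) = card (A - C) + card (B - C)"
    using disjoint fin
    by (subst card_Un_disjoint[symmetric]) (auto intro!: arg_cong[where f = card])
  ultimately show ?thesis
    using card_Int_Diff[OF fin(2), of C] bij_betw_same_card[OF bij] by simp
qed

theorem cohen_macaulay: "cohen_macaulay_graph K (A \<union> B) E"
  unfolding cohen_macaulay_graph_def cohen_macaulay_quot_def
proof (rule order.antisym)
  let ?I = "edge_ideal K (A \<union> B) E"
  show "depth_quot K (A \<union> B) ?I \<le> krull_dim_quot K (A \<union> B) ?I"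
    by (rule depth_quot_le_krull_dim_quot[OF is_idealD(1)[OF is_ideal_edge_ideal]])
  obtain as where as: "distinct as" "set as = A"
    using finite_distinct_list[of A] finite_vertices by auto
  have "krull_dim_quot K (A \<union> B) ?I \<le> enat (length as)"
    using krull_dim_edge_ideal_le[of "card A" K] card_Diff_vertex_cover_le
      distinct_card[OF as(1)] as(2)
    by simp
  also have "\<dots> \<le> depth_quot K (A \<union> B) ?I"
    using depth_quot_ge[OF regular_seq_var_diffs[OF as, of K]] by simp
  finally show "krull_dim_quot K (A \<union> B) ?I \<le> depth_quot K (A \<union> B) ?I" .
qed

end

section \<open>Complete bipartite graphs\<close>

locale complete_bipartite_graph = bipartite_graph A B E for A B :: "'v set" and E :: "'v set set" +
  assumes complete: "\<And>a b. a \<in> A \<Longrightarrow> b \<in> B \<Longrightarrow> {a, b} \<in> E"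
begin

lemma edge_ideal_eq_Int:
  "edge_ideal K (A \<union> B) E = vars_ideal K (A \<union> B) A \<inter> vars_ideal K (A \<union> B) B"
proof -
  have "(\<exists>x y. {x, y} \<in> E \<and> x \<in> keys k \<and> y \<in> keys k) \<longleftrightarrow> keys k \<inter> A \<noteq> {} \<and> keys k \<inter> B \<noteq> {}"
    for k :: "'v \<Rightarrow>\<^sub>0 nat"
    using edges complete by blast
  then show ?thesis
    by (auto simp: edge_ideal_eq vars_ideal_eq monomial_ideal_def)
qed

lemma is_ideal_sides:
  "is_ideal K (A \<union> B) (vars_ideal K (A \<union> B) A)"
  "is_ideal K (A \<union> B) (vars_ideal K (A \<union> B) B)"
  by (auto intro!: is_ideal_gen_ideal)

lemma mult_in_edge_ideal:
  assumes "p \<in> vars_ideal K (A \<union> B) A" "q \<in> vars_ideal K (A \<union> B) B"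
  shows "p * q \<in> edge_ideal K (A \<union> B) E"
proof -
  have "p \<in> polys K (A \<union> B)" "q \<in> polys K (A \<union> B)"
    using assms is_idealD(1)[OF is_ideal_sides(1)] is_idealD(1)[OF is_ideal_sides(2)] by auto
  then show ?thesis
    using assms
    by (simp add: edge_ideal_eq_Int is_ideal_mult_right[OF is_ideal_sides(1)]
        is_idealD(4)[OF is_ideal_sides(2)])
qed

lemma not_regular_mod_edge_ideal:
  assumes nonempty: "A \<noteq> {}" "B \<noteq> {}"
    and f: "f \<in> vars_ideal K (A \<union> B) A \<union> vars_ideal K (A \<union> B) B"
  shows "\<not> regular_mod K (A \<union> B) (edge_ideal K (A \<union> B) E) f"
proof
  assume regular: "regular_mod K (A \<union> B) (edge_ideal K (A \<union> B) E) f"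
  obtain v where v: "v \<in> A \<union> B" "f * var v \<in> edge_ideal K (A \<union> B) E"
  proof (use f in \<open>elim UnE\<close>)
    assume f: "f \<in> vars_ideal K (A \<union> B) A"
    obtain b where "b \<in> B" using nonempty by blast
    then show thesis
      using that[of b] mult_in_edge_ideal[OF f gen_ideal_base, of "var b"] by simp
  next
    assume f: "f \<in> vars_ideal K (A \<union> B) B"
    obtain a where "a \<in> A" using nonempty by blast
    then show thesis
      using that[of a] mult_in_edge_ideal[OF gen_ideal_base f, of "var a"]
      by (simp add: mult.commute)
  qed
  then have "var v \<in> edge_ideal K (A \<union> B) E"
    using regular_modD[OF regular] by simp
  then show False
    using disjoint by (auto simp: edge_ideal_eq_Int vars_ideal_eq monomial_ideal_def)
qed

text \<open>A unit at the origin is regular modulo any monomial ideal, so it can be cancelled from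
  \<open>h * \<beta> \<in> (A)\<close> or from \<open>(1 - h) * \<alpha> \<in> (B)\<close>.\<close>

lemma sum_in_side_if_summand_in_principal:
  assumes \<alpha>: "\<alpha> \<in> vars_ideal K (A \<union> B) A" and \<beta>: "\<beta> \<in> vars_ideal K (A \<union> B) B"
    and principal: "\<alpha> \<in> edge_ideal K (A \<union> B) E + (\<alpha> + \<beta>) *o polys K (A \<union> B)"
  shows "\<alpha> + \<beta> \<in> vars_ideal K (A \<union> B) A \<union> vars_ideal K (A \<union> B) B"
proof -
  let ?P = "vars_ideal K (A \<union> B) A" and ?Q = "vars_ideal K (A \<union> B) B"
  note ideal = is_ideal_sides[of K]
  have \<alpha>\<beta>_polys: "\<alpha> \<in> polys K (A \<union> B)" "\<beta> \<in> polys K (A \<union> B)"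
    using \<alpha> \<beta> is_idealD(1)[OF ideal(1)] is_idealD(1)[OF ideal(2)] by auto
  have cancel: "q \<in> vars_ideal K (A \<union> B) X"
    if "X \<subseteq> A \<union> B" "lookup u 0 \<noteq> 0" "q \<in> polys K (A \<union> B)" "u * q \<in> vars_ideal K (A \<union> B) X"
    for u q X
    using regular_modD[OF regular_mod_vars_ideal_if_const_coeff[OF that(1,2)] that(3,4)] .
  obtain i h where i: "i \<in> ?P" "i \<in> ?Q" and h: "h \<in> polys K (A \<union> B)" and \<alpha>_eq: "\<alpha> = i + (\<alpha> + \<beta>) * h"
    using principal by (auto simp: edge_ideal_eq_Int elt_set_times_def elim!: set_plus_elim)
  have "h * \<beta> = (1 - h) * \<alpha> - i" "(1 - h) * \<alpha> = i + h * \<beta>"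
    using \<alpha>_eq by (simp_all add: algebra_simps)
  moreover have "(1 - h) * \<alpha> - i \<in> ?P" "i + h * \<beta> \<in> ?Q"
    using \<alpha> \<beta> i h by (auto intro!: is_ideal_diff[OF ideal(1)] is_idealD(3)[OF ideal(2)]
        is_idealD(4)[OF ideal(1)] is_idealD(4)[OF ideal(2)])
  ultimately have "h * \<beta> \<in> ?P" "(1 - h) * \<alpha> \<in> ?Q" by simp_all
  moreover have "lookup h 0 \<noteq> 0 \<or> lookup (1 - h) 0 \<noteq> 0" by (auto simp: lookup_minus)
  ultimately have "\<beta> \<in> ?P \<or> \<alpha> \<in> ?Q" using cancel[of A] cancel[of B] \<alpha>\<beta>_polys by blast
  then show ?thesis
    using \<alpha> \<beta> is_idealD(3)[OF ideal(1)] is_idealD(3)[OF ideal(2)] by blast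
qed

text \<open>Writing \<open>f = \<alpha> + \<beta>\<close> with \<open>\<alpha> \<in> (A)\<close> and \<open>\<beta> \<in> (B)\<close>, every element of the maximal ideal multiplies
  \<open>\<alpha>\<close> into \<open>I + (f)\<close>.\<close>

lemma length_regular_seq_le:
  assumes nonempty: "A \<noteq> {}" "B \<noteq> {}" and fs: "regular_seq K (A \<union> B) (edge_ideal K (A \<union> B) E) fs"
  shows "length fs \<le> 1"
proof (rule ccontr)
  let ?I = "edge_ideal K (A \<union> B) E"
  let ?P = "vars_ideal K (A \<union> B) A" and ?Q = "vars_ideal K (A \<union> B) B"
  note ideal = is_ideal_sides[of K]
  assume "\<not> length fs \<le> 1"
  then obtain f g gs where fg: "fs = f # g # gs"
    by (cases fs rule: remdups_adj.cases) auto
  have weakly_regular: "weakly_regular_seq K (A \<union> B) ?I (f # g # gs)"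
    using fs fg by (simp add: regular_seq_iff)
  have regular_f: "regular_mod K (A \<union> B) ?I f"
    and regular_g: "regular_mod K (A \<union> B) (gen_ideal K (A \<union> B) (insert f ?I)) g"
    using weakly_regular_seqD[OF weakly_regular, of 0] weakly_regular_seqD[OF weakly_regular, of 1]
    by (simp_all add: gen_ideal_of_ideal[OF is_ideal_edge_ideal])
  have "max_hom_ideal K (A \<union> B) = ?P + ?Q"
    unfolding max_hom_ideal_def image_Un by (rule gen_ideal_Un) auto
  then obtain \<alpha> \<beta> \<gamma> \<delta> where f: "f = \<alpha> + \<beta>" and g: "g = \<gamma> + \<delta>"
    and parts: "\<alpha> \<in> ?P" "\<beta> \<in> ?Q" "\<gamma> \<in> ?P" "\<delta> \<in> ?Q"
    using fs fg by (auto simp: regular_seq_iff elim!: set_plus_elim)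
  have polys: "\<alpha> \<in> polys K (A \<union> B)" "\<beta> \<in> polys K (A \<union> B)" "\<gamma> \<in> polys K (A \<union> B)" "\<delta> \<in> polys K (A \<union> B)"
    using parts is_idealD(1)[OF ideal(1)] is_idealD(1)[OF ideal(2)] by auto
  have "\<alpha> * \<delta> - \<gamma> * \<beta> \<in> ?I"
    using parts by (intro is_ideal_diff[OF is_ideal_edge_ideal] mult_in_edge_ideal)
  moreover have "g * \<alpha> = (\<alpha> * \<delta> - \<gamma> * \<beta>) + f * \<gamma>" unfolding f g by (simp add: algebra_simps)
  ultimately have "g * \<alpha> \<in> ?I + f *o polys K (A \<union> B)"
    using polys by auto
  then have "\<alpha> \<in> ?I + f *o polys K (A \<union> B)"
    using regular_modD[OF regular_g polys(1)] polys
    by (simp add: gen_ideal_insert[OF is_ideal_edge_ideal] f polys_add)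
  then have "f \<in> ?P \<union> ?Q"
    unfolding f by (rule sum_in_side_if_summand_in_principal[OF parts(1,2)])
  then show False using not_regular_mod_edge_ideal[OF nonempty] regular_f by blast
qed

lemma not_cohen_macaulay:
  assumes nonempty: "A \<noteq> {}" and B: "card B \<ge> 2"
  shows "\<not> cohen_macaulay_graph K (A \<union> B) E"
proof
  let ?I = "edge_ideal K (A \<union> B) E"
  assume "cohen_macaulay_graph K (A \<union> B) E"
  then have "depth_quot K (A \<union> B) ?I = krull_dim_quot K (A \<union> B) ?I"
    by (simp add: cohen_macaulay_graph_def cohen_macaulay_quot_def)
  moreover have "B \<noteq> {}" using B by auto
  then have "depth_quot K (A \<union> B) ?I \<le> enat 1"
    using length_regular_seq_le[OF nonempty] by (intro depth_quot_le) simp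
  moreover have "is_vertex_cover (A \<union> B) E A"
    using edges by (intro vertex_coverI) blast+
  then have "enat (card B) \<le> krull_dim_quot K (A \<union> B) ?I"
    using card_le_krull_dim_edge_ideal[of A K] disjoint
    by (simp add: Un_Diff Diff_triv Int_commute)
  ultimately have "enat (card B) \<le> enat 1" using order.trans by metis
  then show False using B by simp
qed

end

section \<open>Syzygies of monomials\<close>

lemma module_spanE:
  assumes "x \<in> module_span K V B"
  obtains n :: nat and c b where "x = (\<lambda>j. \<Sum>i<n. c i * b i j)"
    "\<forall>i<n. c i \<in> polys K V \<and> b i \<in> B"
  using assms unfolding module_span_def by blast

lemma module_spanI:
  fixes n :: nat
  assumes "\<And>i. i < n \<Longrightarrow> c i \<in> polys K V" "\<And>i. i < n \<Longrightarrow> b i \<in> B"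
  shows "(\<lambda>j. \<Sum>i<n. c i * b i j) \<in> module_span K V B"
  unfolding module_span_def using assms by blast

lemma module_span_0: "(\<lambda>j. 0) \<in> module_span K V B"
  using module_spanI[of 0] by simp

lemma module_span_base: "x \<in> B \<Longrightarrow> x \<in> module_span K V B"
  using module_spanI[of 1 "\<lambda>_. 1" K V "\<lambda>_. x" B] by simp

lemma sum_lessThan_plus_shift:
  fixes f :: "nat \<Rightarrow> 'a::comm_monoid_add"
  shows "(\<Sum>i<n + m. f i) = (\<Sum>i<n. f i) + (\<Sum>i<m. f (n + i))"
  by (induction m) (simp_all add: add.assoc)

lemma module_span_add:
  assumes "x \<in> module_span K V B" "y \<in> module_span K V B"
  shows "(\<lambda>j. x j + y j) \<in> module_span K V B"
proof -
  obtain n :: nat and c b where x: "x = (\<lambda>j. \<Sum>i<n. c i * b i j)"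
    and cb: "\<forall>i<n. c i \<in> polys K V \<and> b i \<in> B"
    using assms(1) by (rule module_spanE)
  obtain m :: nat and d e where y: "y = (\<lambda>j. \<Sum>i<m. d i * e i j)"
    and de: "\<forall>i<m. d i \<in> polys K V \<and> e i \<in> B"
    using assms(2) by (rule module_spanE)
  have "(\<lambda>j. \<Sum>i<n + m. (if i < n then c i else d (i - n)) * (if i < n then b i else e (i - n)) j)
      \<in> module_span K V B"
    using cb de by (intro module_spanI) auto
  then show ?thesis by (simp add: x y sum_lessThan_plus_shift)
qed

lemma module_span_scale:
  assumes "x \<in> module_span K V B" "r \<in> polys K V"
  shows "(\<lambda>j. r * x j) \<in> module_span K V B"
proof -
  obtain n :: nat and c b where x: "x = (\<lambda>j. \<Sum>i<n. c i * b i j)"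
    and cb: "\<forall>i<n. c i \<in> polys K V \<and> b i \<in> B"
    using assms(1) by (rule module_spanE)
  have "(\<lambda>j. \<Sum>i<n. (r * c i) * b i j) \<in> module_span K V B"
    using cb assms(2) by (intro module_spanI) auto
  then show ?thesis by (simp add: x sum_distrib_left mult.assoc)
qed

lemma module_span_sum:
  assumes "\<And>i. i \<in> S \<Longrightarrow> x i \<in> module_span K V B"
  shows "(\<lambda>j. \<Sum>i\<in>S. x i j) \<in> module_span K V B"
  using assms
proof (induction S rule: infinite_finite_induct)
  case (insert i F)
  then show ?case using module_span_add[of "x i" K V B "\<lambda>j. \<Sum>i\<in>F. x i j"] by simp
qed (auto intro: module_span_0)

lemma module_span_keysE:
  assumes x: "x \<in> module_span K V B" and k: "k \<in> keys (x j)"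
  obtains b u v where "b \<in> B" "k = u + v" "v \<in> keys (b j)"
proof -
  obtain n :: nat and c b where cb: "x = (\<lambda>j. \<Sum>i<n. c i * b i j)"
    "\<forall>i<n. c i \<in> polys K V \<and> b i \<in> B"
    using x by (rule module_spanE)
  then obtain i where "i < n" "k \<in> keys (c i * b i j)"
    using k keys_sum[of "\<lambda>i. c i * b i j" "{..<n}"] by blast
  then show thesis using that cb(2) by (metis keys_multE)
qed

definition pair_syz ::
    "('j \<Rightarrow> 'v \<Rightarrow>\<^sub>0 nat) \<Rightarrow> ('v \<Rightarrow>\<^sub>0 nat) \<Rightarrow> 'j \<Rightarrow> 'j \<Rightarrow> 'j \<Rightarrow> ('v, 'k::field) mpoly" where
  "pair_syz e m i j = (\<lambda>l. (if l = i then single (m - e i) 1 else 0) -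
     (if l = j then single (m - e j) 1 else 0))"

lemma pair_syz_refl: "pair_syz e m i i = (\<lambda>l. 0)"
  by (simp add: pair_syz_def)

lemma pair_syz_trans: "pair_syz e m i j = (\<lambda>l. pair_syz e m i i' l + pair_syz e m i' j l)"
  by (simp add: pair_syz_def fun_eq_iff)

lemma pair_syz_eq_scale:
  assumes w: "e i adds w" "e j adds w" and m: "w adds m"
  shows "pair_syz e m i j = (\<lambda>l. single (m - w) 1 * pair_syz e w i j l)"
proof -
  have "m - w + (w - u) = m - u" if "u adds w" for u
  proof -
    have "m = u + (m - w + (w - u))"
      using add_minus_if_adds[OF that] add_minus_if_adds[OF m] by (metis add.assoc add.commute)
    then show ?thesis by (metis add_diff_cancel_left')
  qed
  then show ?thesis
    using w by (auto simp: pair_syz_def fun_eq_iff right_diff_distrib mult_single)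
qed

lemma pair_syz_in_syz_kernel:
  fixes K :: "'k::field itself"
  assumes J: "finite J" "i \<in> J" "j \<in> J" and m: "e i adds m" "e j adds m" "keys m \<subseteq> V"
  shows "pair_syz e m i j \<in> syz_kernel K V J (\<lambda>l. single (e l) 1)"
proof -
  have "single (m - u) (1::'k) * single u 1 = single m 1" if "u adds m" for u
    using add_minus_if_adds[OF that] by (simp add: mult_single add.commute)
  then have "pair_syz e m i j l * single (e l) (1::'k) =
      (if l = i then single m 1 else 0) - (if l = j then single m 1 else 0)" for l
    using m(1,2) by (simp add: pair_syz_def left_diff_distrib)
  then have "(\<Sum>l\<in>J. pair_syz e m i j l * single (e l) (1::'k)) = 0"
    using J by (simp add: sum_subtractf)
  moreover have "pair_syz e m i j l \<in> polys K V" for l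
  proof -
    have "keys (m - u) \<subseteq> V" for u using keys_minus_nat m(3) by (rule order.trans)
    then show ?thesis by (auto simp: pair_syz_def intro!: polys_diff polys_single)
  qed
  ultimately show ?thesis
    using J(2,3) by (auto simp: syz_kernel_def pair_syz_def)
qed

definition syz_component ::
    "('j \<Rightarrow> 'v \<Rightarrow>\<^sub>0 nat) \<Rightarrow> 'j set \<Rightarrow> ('j \<Rightarrow> ('v, 'k) mpoly) \<Rightarrow>
      ('v \<Rightarrow>\<^sub>0 nat) \<Rightarrow> 'j \<Rightarrow> ('v, 'k::field) mpoly" where
  "syz_component e J x m =
     (\<lambda>j. if j \<in> J \<and> e j adds m then single (m - e j) (lookup (x j) (m - e j)) else 0)"

lemma sum_syz_coeffs_eq_0:
  assumes x: "x \<in> syz_kernel K V J (\<lambda>j. single (e j) 1)" and J: "finite J"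
  shows "(\<Sum>j\<in>{j\<in>J. e j adds m}. lookup (x j) (m - e j)) = 0"
proof -
  have "(\<Sum>j\<in>{j\<in>J. e j adds m}. lookup (x j) (m - e j)) = (\<Sum>j\<in>J. lookup (x j * single (e j) 1) m)"
    using J by (intro sum.mono_neutral_cong_left) (auto simp: lookup_mult_monomial)
  also have "\<dots> = lookup (\<Sum>j\<in>J. x j * single (e j) 1) m" by (simp add: lookup_sum)
  also have "\<dots> = 0" using x by (simp add: syz_kernel_def)
  finally show ?thesis .
qed

lemma syz_component_eq_sum_pair_syz:
  fixes K :: "'k::field itself" and x :: "'j \<Rightarrow> ('v, 'k) mpoly"
  assumes x: "x \<in> syz_kernel K V J (\<lambda>j. single (e j) 1)" and J: "finite J"
  shows "syz_component e J x m =
    (\<lambda>l. \<Sum>j\<in>{j\<in>J. e j adds m}. single 0 (lookup (x j) (m - e j)) * pair_syz e m j i l)"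
proof
  fix l
  let ?c = "\<lambda>j. lookup (x j) (m - e j)" and ?J = "{j\<in>J. e j adds m}"
  have "(\<Sum>j\<in>?J. single 0 (?c j) * pair_syz e m j i l) =
      (\<Sum>j\<in>?J. if l = j then single (m - e j) (?c j) else 0) -
      (\<Sum>j\<in>?J. if l = i then single (m - e i) (?c j) else 0)"
    unfolding sum_subtractf[symmetric]
    by (intro sum.cong) (auto simp: pair_syz_def right_diff_distrib mult_single)
  also have "(\<Sum>j\<in>?J. if l = i then single (m - e i) (?c j) else 0) = 0"
    using sum_syz_coeffs_eq_0[OF x J, of m] sum_single_same[of "m - e i" ?c ?J]
    by (cases "l = i") simp_all
  finally show "syz_component e J x m l = (\<Sum>j\<in>?J. single 0 (?c j) * pair_syz e m j i l)"
    using J by (simp add: syz_component_def)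
qed

lemma sum_syz_components:
  assumes J: "finite J" and support: "\<And>j. j \<notin> J \<Longrightarrow> x j = 0"
  shows "(\<Sum>m\<in>(\<Union>j\<in>J. (\<lambda>k. e j + k) ` keys (x j)). syz_component e J x m j) = x j"
    (is "(\<Sum>m\<in>?S. _) = _")
proof (rule poly_mapping_eqI)
  fix k
  have finite: "finite ?S" using J by simp
  have "lookup (syz_component e J x m j) k = (if m = e j + k then lookup (x j) k else 0)" for m
    using support[of j] add_minus_if_adds[of "e j" m]
    by (cases "j \<in> J") (auto simp: syz_component_def lookup_single when_def)
  then have "lookup (\<Sum>m\<in>?S. syz_component e J x m j) k = (if e j + k \<in> ?S then lookup (x j) k else 0)"
    by (simp add: lookup_sum finite)
  moreover have "e j + k \<in> ?S" if "lookup (x j) k \<noteq> 0"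
  proof -
    have "j \<in> J" using that support[of j] by (metis lookup_zero)
    moreover have "k \<in> keys (x j)" using that by (simp add: in_keys_iff)
    ultimately show ?thesis by blast
  qed
  ultimately show "lookup (\<Sum>m\<in>?S. syz_component e J x m j) k = lookup (x j) k"
    by auto
qed

text \<open>A syzygy splits into its components of monomial degree \<open>m\<close>, each of which is a combination of
  pair syzygies of the same degree.\<close>

lemma syz_kernel_subset_module_span:
  fixes K :: "'k::field itself"
  assumes J: "finite J" and e: "\<And>j. j \<in> J \<Longrightarrow> keys (e j) \<subseteq> V"
    and pairs: "\<And>i j m. i \<in> J \<Longrightarrow> j \<in> J \<Longrightarrow> e i adds m \<Longrightarrow> e j adds m \<Longrightarrow> keys m \<subseteq> V \<Longrightarrow>
      pair_syz e m i j \<in> module_span K V B"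
  shows "syz_kernel K V J (\<lambda>j. single (e j) 1) \<subseteq> module_span K V B"
proof
  fix x assume x: "x \<in> syz_kernel K V J (\<lambda>j. single (e j) 1)"
  have "syz_component e J x m \<in> module_span K V B" if m: "keys m \<subseteq> V" for m
  proof (cases "\<exists>i\<in>J. e i adds m")
    case True
    then obtain i where "i \<in> J" "e i adds m" by blast
    then show ?thesis
      unfolding syz_component_eq_sum_pair_syz[OF x J, of m i]
      using m by (intro module_span_sum module_span_scale pairs polys_const) auto
  next
    case False
    then have "syz_component e J x m = (\<lambda>j. 0)" by (auto simp: syz_component_def fun_eq_iff)
    then show ?thesis by (simp add: module_span_0)
  qed
  moreover have "keys m \<subseteq> V" if "m \<in> (\<Union>j\<in>J. (\<lambda>k. e j + k) ` keys (x j))" for m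
    using that x e by (fastforce simp: syz_kernel_def keys_plus_nat dest: polysD)
  ultimately have "(\<lambda>j. \<Sum>m\<in>(\<Union>j\<in>J. (\<lambda>k. e j + k) ` keys (x j)). syz_component e J x m j)
      \<in> module_span K V B"
    by (intro module_span_sum) blast
  then show "x \<in> module_span K V B"
    using sum_syz_components[OF J, of x e] x by (simp add: syz_kernel_def)
qed

section \<open>Syzygies of cover ideals\<close>

definition ind_mon :: "'v set \<Rightarrow> ('v \<Rightarrow>\<^sub>0 nat)" where
  "ind_mon C = (\<Sum>t\<in>C. single t 1)"

lemma lookup_ind_mon: "finite C \<Longrightarrow> lookup (ind_mon C) t = (if t \<in> C then 1 else 0)"
  by (simp add: ind_mon_def lookup_sum lookup_single when_def sum.delta)

lemma keys_ind_mon: "finite C \<Longrightarrow> keys (ind_mon C) = C"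
  by (auto simp: in_keys_iff lookup_ind_mon split: if_splits)

lemma mono_deg_ind_mon: "finite C \<Longrightarrow> mono_deg (ind_mon C) = card C"
  by (simp add: mono_deg_def keys_ind_mon lookup_ind_mon)

lemma ind_mon_adds_iff: "finite C \<Longrightarrow> ind_mon C adds m \<longleftrightarrow> C \<subseteq> keys m"
  by (auto simp: adds_iff_lookup_le lookup_ind_mon in_keys_iff Suc_le_eq split: if_splits)

lemma ind_mon_Un_minus: "finite C \<Longrightarrow> finite D \<Longrightarrow> ind_mon (C \<union> D) - ind_mon C = ind_mon (D - C)"
  by (rule poly_mapping_eqI) (simp add: lookup_minus lookup_ind_mon)

lemma cover_monomial_eq: "cover_monomial = (\<lambda>C. single (ind_mon C) 1)"
proof
  show "cover_monomial C = single (ind_mon C) 1" for C :: "'v set"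
    unfolding cover_monomial_def ind_mon_def var_def by (rule prod_single)
qed

lemma pair_syz_ind_mon_union:
  assumes "finite C" "finite D"
  shows "pair_syz ind_mon (ind_mon (C \<union> D)) C D =
    (\<lambda>l. (if l = C then single (ind_mon (D - C)) 1 else 0) -
      (if l = D then single (ind_mon (C - D)) 1 else 0))"
  using assms ind_mon_Un_minus[of C D] ind_mon_Un_minus[of D C]
  by (auto simp: pair_syz_def Un_commute fun_eq_iff)

context unmixed_graph
begin

abbreviation min_covers :: "'v set set" where
  "min_covers \<equiv> {C. min_vertex_cover V E C}"

abbreviation cover_syz :: "'k::field itself \<Rightarrow> ('v set \<Rightarrow> ('v, 'k) mpoly) set" where
  "cover_syz K \<equiv> syz_kernel K V min_covers cover_monomial"

abbreviation linear_cover_syz :: "'k::field itself \<Rightarrow> ('v set \<Rightarrow> ('v, 'k) mpoly) set" where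
  "linear_cover_syz K \<equiv> {x \<in> cover_syz K. \<forall>C\<in>min_covers. linear_form (x C)}"

lemma cover_ideal_linearly_presented_iff:
  fixes K :: "'k::field itself"
  shows
  "cover_ideal_linearly_presented K V E \<longleftrightarrow> cover_syz K \<subseteq> module_span K V (linear_cover_syz K)"
proof -
  have "homogeneous_of_deg (card C) (cover_monomial C)" if "min_vertex_cover V E C" for C
    using finite_min_vertex_cover[OF that]
    by (simp add: homogeneous_of_deg_def cover_monomial_eq mono_deg_ind_mon)
  then have "\<exists>d. \<forall>C\<in>min_covers. homogeneous_of_deg d (cover_monomial C :: ('v, 'k) mpoly)"
    using card_min_vertex_covers_eq by (metis mem_Collect_eq)
  then show ?thesis
    by (simp add: cover_ideal_linearly_presented_def linearly_presented_def)
qed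

lemma pair_syz_in_cover_syz:
  assumes C: "min_vertex_cover V E C" and D: "min_vertex_cover V E D"
  shows "pair_syz ind_mon (ind_mon (C \<union> D)) C D \<in> cover_syz K"
  unfolding cover_monomial_eq
  using finite_min_vertex_covers C D finite_min_vertex_cover[OF C] finite_min_vertex_cover[OF D]
    min_vertex_coverD(2)[OF C] min_vertex_coverD(2)[OF D]
  by (intro pair_syz_in_syz_kernel) (auto simp: ind_mon_adds_iff keys_ind_mon)

lemma pair_syz_exchange_in_linear_cover_syz:
  assumes C: "min_vertex_cover V E C" and D: "min_vertex_cover V E D"
    and a: "C - D = {a}" and b: "D - C = {b}"
  shows "pair_syz ind_mon (ind_mon (C \<union> D)) C D \<in> linear_cover_syz K"
proof -
  have "C \<noteq> D" using a by auto
  then have "linear_form (pair_syz ind_mon (ind_mon (C \<union> D)) C D X)" for X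
    unfolding pair_syz_ind_mon_union[OF C[THEN finite_min_vertex_cover] 
        D[THEN finite_min_vertex_cover]] a b
    by (auto simp: homogeneous_of_deg_def mono_deg_ind_mon)
  then show ?thesis using pair_syz_in_cover_syz[OF C D] by blast
qed

lemma pair_syz_in_span_linear_cover_syz:
  assumes thin: "thin_complete_pairs V E"
    and C: "min_vertex_cover V E C" and D: "min_vertex_cover V E D"
    and m: "keys m \<subseteq> V" "C \<union> D \<subseteq> keys m"
  shows "pair_syz ind_mon m C D \<in> module_span K V (linear_cover_syz K)"
  using thin C D m(2)
proof (induction C D rule: min_vertex_cover_pair_induct)
  case (equal C)
  then show ?case by (simp add: pair_syz_refl module_span_0)
next
  case (exchange C D a b)
  have fin: "finite C" "finite D"
    using exchange(1,2) finite_min_vertex_cover by auto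
  have "keys (m - ind_mon (C \<union> D)) \<subseteq> V" using keys_minus_nat m(1) by (rule order.trans)
  then have "(\<lambda>l. single (m - ind_mon (C \<union> D)) 1 * pair_syz ind_mon (ind_mon (C \<union> D)) C D l)
      \<in> module_span K V (linear_cover_syz K)"
    by (intro module_span_scale module_span_base polys_single
        pair_syz_exchange_in_linear_cover_syz[OF exchange(1-4)])
  then show ?case
    using exchange.prems fin
    by (subst pair_syz_eq_scale[of _ _ "ind_mon (C \<union> D)"])
      (auto simp: ind_mon_adds_iff keys_ind_mon)
next
  case (split C D J)
  then show ?case
    by (subst pair_syz_trans[of _ _ _ _ J]) (intro module_span_add; blast)
qed

lemma linearly_presented_if_thin:
  assumes thin: "thin_complete_pairs V E"
  shows "cover_ideal_linearly_presented K V E"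
  unfolding cover_ideal_linearly_presented_iff cover_monomial_eq
proof (rule syz_kernel_subset_module_span[OF finite_min_vertex_covers])
  show "keys (ind_mon C) \<subseteq> V" if "C \<in> min_covers" for C
    using that by (simp add: keys_ind_mon finite_min_vertex_cover min_vertex_coverD(2))
  show "pair_syz ind_mon m C D
      \<in> module_span K V {x \<in> syz_kernel K V min_covers (\<lambda>C. single (ind_mon C) 1).
          \<forall>C\<in>min_covers. linear_form (x C)}"
    if "C \<in> min_covers" "D \<in> min_covers" "ind_mon C adds m" "ind_mon D adds m" "keys m \<subseteq> V" for C D m
    using pair_syz_in_span_linear_cover_syz[OF thin, of C D m K] that
    by (simp add: ind_mon_adds_iff finite_min_vertex_cover cover_monomial_eq)
qed

end

locale cover_pair = unmixed_graph V E for V :: "'v set" and E :: "'v set set" +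
  fixes C D :: "'v set"
  assumes C: "min_vertex_cover V E C" and D: "min_vertex_cover V E D"

locale thick_complete_cover_pair = cover_pair V E C D
  for V :: "'v set" and E :: "'v set set" and C D +
  assumes complete: "complete_between E (C - D) (D - C)" and thick: "card (D - C) > 1"
begin

lemma only_min_vertex_cover_in_insert:
  assumes triangle_free: "no_3_cycle E" and t: "t \<in> D - C"
    and X: "min_vertex_cover V E X" "X \<subseteq> insert t C"
  shows "X = C"
proof (rule ccontr)
  assume "X \<noteq> C"
  have card: "card X = card C" by (rule card_min_vertex_covers_eq[OF X(1) C])
  have finite_C: "finite C" by (rule finite_min_vertex_cover[OF C])
  have "\<not> C \<subseteq> X"
    using card_subset_eq[OF finite_min_vertex_cover[OF X(1)], of C] card \<open>X \<noteq> C\<close> by metis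
  then obtain s where s: "s \<in> C" "s \<notin> X" by blast
  have "X \<subseteq> insert t C - {s}" using X(2) s by blast
  moreover have "card (insert t C - {s}) = card X" using card t s finite_C by simp
  ultimately have "X = insert t C - {s}" using finite_C by (intro card_subset_eq) auto
  then show False
    using not_min_vertex_cover_exchange[OF triangle_free C D complete thick t s(1)] X(1) by simp
qed

lemma cover_syz_coeff_eq_0:
  assumes triangle_free: "no_3_cycle E" and x: "x \<in> cover_syz K" and t: "t \<in> D - C"
  shows "lookup (x C) (single t 1) = 0"
proof -
  define m where "m = ind_mon C + single t 1"
  have finite_C: "finite C" by (rule finite_min_vertex_cover[OF C])
  have adds_m: "ind_mon X adds m \<longleftrightarrow> X = C" if "X \<in> min_covers" for X
    using that only_min_vertex_cover_in_insert[OF triangle_free t, of X]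
      finite_min_vertex_cover[of X] finite_C
    by (auto simp: m_def ind_mon_adds_iff keys_plus_nat keys_ind_mon)
  have "(\<Sum>X\<in>{X \<in> min_covers. ind_mon X adds m}. lookup (x X) (m - ind_mon X)) = 0"
    using x finite_min_vertex_covers unfolding cover_monomial_eq by (rule sum_syz_coeffs_eq_0)
  moreover have "{X \<in> min_covers. ind_mon X adds m} = {C}" using adds_m C by auto
  ultimately show ?thesis by (simp add: m_def)
qed

lemma not_linearly_presented:
  assumes triangle_free: "no_3_cycle E"
  shows "\<not> cover_ideal_linearly_presented K V E"
proof
  assume "cover_ideal_linearly_presented K V E"
  then have span: "pair_syz ind_mon (ind_mon (C \<union> D)) C D \<in> module_span K V (linear_cover_syz K)"
    using pair_syz_in_cover_syz[OF C D] unfolding cover_ideal_linearly_presented_iff by blast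
  have fin: "finite C" "finite D" using finite_min_vertex_cover C D by auto
  have "C \<noteq> D" using thick by auto
  then have "ind_mon (D - C) \<in> keys (pair_syz ind_mon (ind_mon (C \<union> D)) C D C)"
    by (simp add: pair_syz_ind_mon_union[OF fin])
  then obtain b u v where b: "b \<in> linear_cover_syz K"
    and uv: "ind_mon (D - C) = u + v" "v \<in> keys (b C)"
    by (rule module_span_keysE[OF span])
  have "mono_deg v = 1" using b uv(2) C by (auto simp: homogeneous_of_deg_def)
  then obtain t where t: "v = single t 1" by (rule mono_deg_1E)
  then have "t \<in> keys (ind_mon (D - C))" by (simp add: uv(1) keys_plus_nat)
  then have "t \<in> D - C" using fin by (simp add: keys_ind_mon)
  then have "lookup (b C) v = 0" using cover_syz_coeff_eq_0[OF triangle_free, of b K t] b t by simp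
  then show False using uv(2) by (simp add: in_keys_iff)
qed

end

lemma (in unmixed_graph) thin_complete_pairsI:
  assumes "\<And>C D. thick_complete_cover_pair V E C D \<Longrightarrow> False"
  shows "thin_complete_pairs V E"
  unfolding thin_complete_pairs_def
proof (intro allI impI, elim conjE, rule ccontr)
  fix C D assume CD: "min_vertex_cover V E C" "min_vertex_cover V E D"
    "complete_between E (C - D) (D - C)" "\<not> card (C - D) \<le> 1"
  then have "thick_complete_cover_pair V E C D"
    using card_Diff_min_vertex_covers[OF CD(1,2)] by unfold_locales auto
  then show False by (rule assms)
qed

lemma (in unmixed_graph) linearly_presented_iff_thin:
  assumes "no_3_cycle E"
  shows "cover_ideal_linearly_presented K V E \<longleftrightarrow> thin_complete_pairs V E"
  using linearly_presented_if_thin thick_complete_cover_pair.not_linearly_presented[OF _ assms]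
    thin_complete_pairsI by blast

section \<open>Symmetric differences of minimal vertex covers\<close>

context cover_pair
begin

abbreviation diff_vertices :: "'v set" where
  "diff_vertices \<equiv> sym_diff C D"

abbreviation diff_edges :: "'v set set" where
  "diff_edges \<equiv> induced_edges E diff_vertices"

sublocale diff: bipartite_graph "C - D" "D - C" diff_edges
proof
  show "simple_graph diff_vertices diff_edges"
    using simple min_vertex_coverD(2)[OF C] min_vertex_coverD(2)[OF D]
    by (auto simp: simple_graph_def induced_edges_def intro: finite_subset)
  show "x \<in> C - D \<and> y \<in> D - C \<or> x \<in> D - C \<and> y \<in> C - D" if "{x, y} \<in> diff_edges" for x y
    using that min_vertex_coverD(3)[OF C, of x y] min_vertex_coverD(3)[OF D, of x y]
    by (auto simp: induced_edges_def)
qed blast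

lemma diff_neighbour:
  assumes X: "min_vertex_cover V E X" and Y: "min_vertex_cover V E Y" and x: "x \<in> X - Y"
  shows "\<exists>y. {x, y} \<in> induced_edges E (sym_diff X Y) \<and> y \<notin> X - Y"
proof -
  obtain y where y: "{x, y} \<in> E" "y \<notin> X" using min_vertex_cover_neighbour[OF X] x by blast
  then have "y \<in> Y" using min_vertex_coverD(3)[OF Y y(1)] x by blast
  then show ?thesis using y x by (auto simp: induced_edges_def)
qed

lemma min_vertex_cover_diff:
  "min_vertex_cover diff_vertices diff_edges (C - D)"
  "min_vertex_cover diff_vertices diff_edges (D - C)"
proof -
  have "is_vertex_cover diff_vertices diff_edges (C - D)"
    "is_vertex_cover diff_vertices diff_edges (D - C)"
    by (rule diff.vertex_coverI; use diff.edges in blast)+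
  then show "min_vertex_cover diff_vertices diff_edges (C - D)"
    "min_vertex_cover diff_vertices diff_edges (D - C)"
    using diff_neighbour[OF C D] diff_neighbour[OF D C]
    by (auto intro!: min_vertex_coverI simp: Un_commute)
qed

lemma min_vertex_cover_Un_Int:
  assumes unmixed_diff: "unmixed diff_vertices diff_edges"
    and X: "min_vertex_cover diff_vertices diff_edges X"
  shows "min_vertex_cover V E (X \<union> (C \<inter> D))"
proof (rule min_vertex_cover_if_card_eq[OF C])
  have X_sub: "X \<subseteq> diff_vertices" by (rule min_vertex_coverD(2)[OF X])
  have fin: "finite C" "finite D" using finite_min_vertex_cover C D by auto
  show "is_vertex_cover V E (X \<union> (C \<inter> D))"
  proof (rule vertex_coverI)
    show "X \<union> (C \<inter> D) \<subseteq> V" using X_sub min_vertex_coverD(2)[OF C] min_vertex_coverD(2)[OF D] by blast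
    fix x y assume xy: "{x, y} \<in> E" "x \<notin> X \<union> (C \<inter> D)"
    show "y \<in> X \<union> (C \<inter> D)"
    proof (rule ccontr)
      assume y: "y \<notin> X \<union> (C \<inter> D)"
      have yx: "{y, x} \<in> E" using xy(1) by (simp add: insert_commute)
      have "x \<in> diff_vertices" "y \<in> diff_vertices"
        using min_vertex_coverD(3)[OF C xy(1)] min_vertex_coverD(3)[OF D xy(1)]
          min_vertex_coverD(3)[OF C yx] min_vertex_coverD(3)[OF D yx] xy(2) y by blast+
      then have "{x, y} \<in> diff_edges" using xy(1) by (simp add: induced_edges_def)
      then show False using min_vertex_coverD(3)[OF X] xy(2) y by blast
    qed
  qed
  have "card X = card (C - D)"
    using unmixed_diff X min_vertex_cover_diff(1) unfolding unmixed_def by blast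
  moreover have "card (X \<union> (C \<inter> D)) = card X + card (C \<inter> D)"
    using X_sub fin by (intro card_Un_disjoint) (auto intro: finite_subset)
  ultimately show "card (X \<union> (C \<inter> D)) = card C"
    using card_Int_Diff[OF fin(1), of D] by simp
qed

lemma thin_complete_pairs_diff:
  assumes thin: "thin_complete_pairs V E" and unmixed_diff: "unmixed diff_vertices diff_edges"
  shows "thin_complete_pairs diff_vertices diff_edges"
  unfolding thin_complete_pairs_def
proof (intro allI impI, elim conjE)
  fix X Y
  assume X: "min_vertex_cover diff_vertices diff_edges X"
    and Y: "min_vertex_cover diff_vertices diff_edges Y"
    and "complete_between diff_edges (X - Y) (Y - X)"
  then have "complete_between E (X - Y) (Y - X)"
    by (auto simp: complete_between_def induced_edges_def)
  moreover have "X \<union> (C \<inter> D) - (Y \<union> (C \<inter> D)) = X - Y" "Y \<union> (C \<inter> D) - (X \<union> (C \<inter> D)) = Y - X"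
    using min_vertex_coverD(2)[OF X] min_vertex_coverD(2)[OF Y] by blast+
  ultimately show "card (X - Y) \<le> 1"
    using thin min_vertex_cover_Un_Int[OF unmixed_diff X] min_vertex_cover_Un_Int[OF unmixed_diff Y]
    unfolding thin_complete_pairs_def by metis
qed

lemma cohen_macaulay_diff:
  assumes thin: "thin_complete_pairs V E" and unmixed_diff: "unmixed diff_vertices diff_edges"
  shows "cohen_macaulay_graph K diff_vertices diff_edges"
proof -
  interpret diff: unmixed_bipartite_graph "C - D" "D - C" diff_edges
    by unfold_locales (rule unmixed_diff)
  have Diff: "C - D - (D - C) = C - D" "D - C - (C - D) = D - C" by blast+
  obtain \<mu> where \<mu>: "antisym_matching diff_edges (C - D) (D - C) \<mu>"
    using diff.antisym_matching_exists[OF thin_complete_pairs_diff[OF thin unmixed_diff]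
        min_vertex_cover_diff]
    unfolding Diff by blast
  have "poset_bipartite_graph (C - D) (D - C) diff_edges \<mu>"
  proof
    show "bij_betw \<mu> (C - D) (D - C)"
      using \<mu> by (simp add: antisym_matching_def)
    show "{a, \<mu> a} \<in> diff_edges" if "a \<in> C - D" for a
      using \<mu> that by (simp add: antisym_matching_def)
    show "a = b" if "a \<in> C - D" "b \<in> C - D" "{a, \<mu> b} \<in> diff_edges" "{b, \<mu> a} \<in> diff_edges" for a b
      using \<mu> that unfolding antisym_matching_def by blast
  qed (rule diff.antisym_matching_trans[OF min_vertex_cover_diff(1) \<mu>])
  then show ?thesis by (rule poset_bipartite_graph.cohen_macaulay)
qed

end

context thick_complete_cover_pair
begin

sublocale diff: complete_bipartite_graph "C - D" "D - C" diff_edges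
proof
  show "{a, b} \<in> diff_edges" if "a \<in> C - D" "b \<in> D - C" for a b
    using that complete by (auto simp: complete_between_def induced_edges_def)
qed

lemma unmixed_diff: "unmixed diff_vertices diff_edges"
proof -
  have "X = C - D \<or> X = D - C" if X: "min_vertex_cover diff_vertices diff_edges X" for X
  proof -
    have "C - D \<subseteq> X \<or> D - C \<subseteq> X"
      using min_vertex_coverD(3)[OF X diff.complete] by blast
    then show ?thesis
      using X min_vertex_cover_diff[THEN min_vertex_coverD(1)] unfolding min_vertex_cover_def
      by blast
  qed
  then show ?thesis
    using card_Diff_min_vertex_covers[OF C D] unfolding unmixed_def by metis
qed

lemma not_cohen_macaulay_diff: "\<not> cohen_macaulay_graph K diff_vertices diff_edges"
proof (rule diff.not_cohen_macaulay)
  show "C - D \<noteq> {}" using card_Diff_min_vertex_covers[OF C D] thick by force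
  show "card (D - C) \<ge> 2" using thick by simp
qed

end

lemma (in unmixed_graph) thin_iff_cohen_macaulay_sym_diffs:
  "thin_complete_pairs V E \<longleftrightarrow>
    (\<forall>C D. min_vertex_cover V E C \<and> min_vertex_cover V E D \<and> C \<noteq> D \<and>
       unmixed (sym_diff C D) (induced_edges E (sym_diff C D)) \<longrightarrow>
       cohen_macaulay_graph K (sym_diff C D) (induced_edges E (sym_diff C D)))"
    (is "_ \<longleftrightarrow> ?cm")
proof
  assume thin: "thin_complete_pairs V E"
  show ?cm
  proof (intro allI impI, elim conjE)
    fix C D assume "min_vertex_cover V E C" "min_vertex_cover V E D"
      and unmixed_diff: "unmixed (sym_diff C D) (induced_edges E (sym_diff C D))"
    then interpret cover_pair V E C D by unfold_locales
    show "cohen_macaulay_graph K (sym_diff C D) (induced_edges E (sym_diff C D))"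
      by (rule cohen_macaulay_diff[OF thin unmixed_diff])
  qed
next
  assume cm: ?cm
  show "thin_complete_pairs V E"
  proof (rule thin_complete_pairsI)
    fix C D assume "thick_complete_cover_pair V E C D"
    then interpret thick_complete_cover_pair V E C D .
    have "C \<noteq> D" using thick by auto
    then show False using cm C D unmixed_diff not_cohen_macaulay_diff by blast
  qed
qed

theorem theorem5p17:
  fixes V :: "'v set" and E :: "'v set set"
  assumes "simple_graph V E"
    and "unmixed V E"
    and "no_3_cycle E"
    and "no_5_cycle E"
  shows "cover_ideal_linearly_presented TYPE('k::field) V E \<longleftrightarrow>
    (\<forall>C1 C2. min_vertex_cover V E C1 \<and> min_vertex_cover V E C2 \<and> C1 \<noteq> C2 \<and>
       unmixed (C1 \<union> C2 - C1 \<inter> C2) (induced_edges E (C1 \<union> C2 - C1 \<inter> C2)) \<longrightarrow>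
       cohen_macaulay_graph TYPE('k) (C1 \<union> C2 - C1 \<inter> C2) (induced_edges E (C1 \<union> C2 - C1 \<inter> C2)))"
proof -
  interpret unmixed_graph V E
    using assms(1,2) by unfold_locales
  have "C1 \<union> C2 - C1 \<inter> C2 = sym_diff C1 C2" for C1 C2 :: "'v set" by blast
  then show ?thesis
    by (simp only: linearly_presented_iff_thin[OF assms(3)]
        thin_iff_cohen_macaulay_sym_diffs[of "TYPE('k)"])
qed

end
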